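(* Let $\mathcal{H}$ be a complex Hilbert space and let $A,B\in\mathcal{B}(\mathcal{H})$. Then, for all $t\in[0,1]$, $$w(AB)\leq\frac14\left\||A|^{2t}+|B^*|^{2(1-t)}\right\|\left\||B|^{2t}+|A^*|^{2(1-t)}\right\|.$$ In particular, for $t=\frac12$, $$w(AB)\leq\frac14\left\||A|+|B^*|\right\|\left\||B|+|A^*|\right\|.$$
   Context: $\mathcal{B}(\mathcal{H})$ is the algebra of bounded linear operators on $\mathcal{H}$ with operator norm $\|\cdot\|$. For $A\in\mathcal{B}(\mathcal{H})$, $|A|=(A^*A)^{1/2}$ and $|A^*|=(AA^* )^{1/2}$, and the numerical radius is $w(A)=\sup\{|\langle Ax,x\rangle|: x\in\mathcal{H},\ \|x\|=1\}$. Powers of positive operators are given by the continuous functional calculus, with the zeroth power of any positive operator equal to the identity $I$. *)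

theory Defs
  imports "HOL-Analysis.Analysis" "HOL-Computational_Algebra.Polynomial"
begin

class complex_vector = real_vector +
  fixes scaleC :: "complex \<Rightarrow> 'a \<Rightarrow> 'a" (infixr "*\<^sub>C" 75)
  assumes scaleC_of_real: "complex_of_real r *\<^sub>C x = r *\<^sub>R x"
    and scaleC_add_right: "a *\<^sub>C (x + y) = a *\<^sub>C x + a *\<^sub>C y"
    and scaleC_add_left: "(a + b) *\<^sub>C x = a *\<^sub>C x + b *\<^sub>C x"
    and scaleC_scaleC: "a *\<^sub>C (b *\<^sub>C x) = (a * b) *\<^sub>C x"

text \<open>
  The complex inner product is linear in its first argument. Its real part is the inner product
  of class \<^class>\<open>real_inner\<close>; that class supplies positive definiteness and the norm
  \<open>norm x = sqrt (inner x x) = sqrt (Re (cinner x x))\<close>, together with the topology it induces.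
\<close>

class complex_inner = complex_vector + real_inner +
  fixes cinner :: "'a \<Rightarrow> 'a \<Rightarrow> complex"
  assumes cinner_commute: "cinner x y = cnj (cinner y x)"
    and cinner_add_left: "cinner (x + y) z = cinner x z + cinner y z"
    and cinner_scaleC_left: "cinner (c *\<^sub>C x) y = c * cinner x y"
    and Re_cinner: "Re (cinner x y) = inner x y"

class complex_hilbert = complex_inner + complete_space

instantiation complex :: complex_hilbert
begin

definition scaleC_complex :: "complex \<Rightarrow> complex \<Rightarrow> complex"
  where "scaleC_complex c x = c * x"

definition cinner_complex :: "complex \<Rightarrow> complex \<Rightarrow> complex"
  where "cinner_complex x y = x * cnj y"

instance
  by standard
    (simp_all add: scaleC_complex_def cinner_complex_def scaleR_conv_of_real inner_complex_def
      algebra_simps)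

end

text \<open>
  The elements of \<open>B(H)\<close> are the bounded real-linear maps \<open>T :: 'a \<Rightarrow>\<^sub>L 'a\<close> satisfying
  \<open>clinear_op T\<close>. Sum, composition \<open>o\<^sub>L\<close> and operator norm are those of
  \<^type>\<open>blinfun\<close>.
\<close>

definition clinear_op :: "('a::complex_inner \<Rightarrow>\<^sub>L 'a) \<Rightarrow> bool"
  where "clinear_op T \<longleftrightarrow> (\<forall>c x. T (c *\<^sub>C x) = c *\<^sub>C T x)"

definition adj :: "('a::complex_inner \<Rightarrow>\<^sub>L 'a) \<Rightarrow> ('a \<Rightarrow>\<^sub>L 'a)"
  where "adj T = (THE S. clinear_op S \<and> (\<forall>x y. cinner (T x) y = cinner x (S y)))"

definition spectrum :: "('a::complex_inner \<Rightarrow>\<^sub>L 'a) \<Rightarrow> complex set"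
  where "spectrum T = {l. \<not> (\<exists>S :: 'a \<Rightarrow>\<^sub>L 'a. clinear_op S \<and>
           (\<forall>x. S (T x - l *\<^sub>C x) = x) \<and> (\<forall>x. T (S x) - l *\<^sub>C S x = x))}"

definition poly_op :: "real poly \<Rightarrow> ('a::real_normed_vector \<Rightarrow>\<^sub>L 'a) \<Rightarrow> ('a \<Rightarrow>\<^sub>L 'a)"
  where "poly_op p T = (\<Sum>i\<le>degree p. coeff p i *\<^sub>R (((o\<^sub>L) T ^^ i) id_blinfun))"

text \<open>
  Continuous functional calculus of a self-adjoint operator \<open>T\<close>, whose spectrum is real, for a
  real function \<open>f\<close> continuous on the spectrum: \<open>f(T)\<close> is the limit in operator norm of
  \<open>p\<^sub>n(T)\<close>, where the polynomials \<open>p\<^sub>n\<close> converge to \<open>f\<close> uniformly on the spectrum.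
\<close>

definition cfc :: "(real \<Rightarrow> real) \<Rightarrow> ('a::complex_inner \<Rightarrow>\<^sub>L 'a) \<Rightarrow> ('a \<Rightarrow>\<^sub>L 'a)"
  where "cfc f T = (THE S. \<exists>p :: nat \<Rightarrow> real poly.
           uniform_limit {x. complex_of_real x \<in> spectrum T} (\<lambda>n. poly (p n)) f sequentially \<and>
           (\<lambda>n. poly_op (p n) T) \<longlonglongrightarrow> S)"

text \<open>
  Powers with exponent \<open>s \<ge> 0\<close> of a positive operator. The case \<open>s = 0\<close> is separate because
  \<open>0 powr 0 = 0\<close>, whereas the zeroth power of an operator is the identity.
\<close>

definition op_powr :: "('a::complex_inner \<Rightarrow>\<^sub>L 'a) \<Rightarrow> real \<Rightarrow> ('a \<Rightarrow>\<^sub>L 'a)"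
  where "op_powr T s = (if s = 0 then id_blinfun else cfc (\<lambda>x. x powr s) T)"

definition op_abs :: "('a::complex_inner \<Rightarrow>\<^sub>L 'a) \<Rightarrow> ('a \<Rightarrow>\<^sub>L 'a)"
  where "op_abs T = op_powr (adj T o\<^sub>L T) (1/2)"

text \<open>
  Inserting \<open>0\<close> only matters on the zero space, which has no unit vectors: the supremum is taken
  among nonnegative reals, so that the supremum of the empty set is \<open>0\<close>.
\<close>

definition numerical_radius :: "('a::complex_inner \<Rightarrow>\<^sub>L 'a) \<Rightarrow> real"
  where "numerical_radius T = Sup (insert 0 {cmod (cinner (T x) x) | x. norm x = 1})"

end

theory Submission imports Defs "HOL-Computational_Algebra.Fundamental_Theorem_Algebra"
begin

text \<open>
  With \<open>P = |A|\<^sup>t\<close>, \<open>Q = |B\<^sup>*|\<^bsup>1-t\<^esup>\<close> and polar decompositions, \<open>B x = Q b\<close> with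
  \<open>\<parallel>b\<parallel> \<le> \<parallel>|B|\<^sup>t x\<parallel>\<close> and \<open>A\<^sup>* y = P a\<close> with \<open>\<parallel>a\<parallel> \<le> \<parallel>|A\<^sup>*|\<^bsup>1-t\<^esup> y\<parallel>\<close>. Since
  \<open>2 \<parallel>P Q\<parallel> \<le> \<parallel>P\<^sup>2 + Q\<^sup>2\<parallel>\<close>, the form \<open>\<langle>A B x, y\<rangle> = \<langle>Q b, P a\<rangle>\<close> is at most
  \<open>\<parallel>P\<^sup>2 + Q\<^sup>2\<parallel> (\<parallel>a\<parallel>\<^sup>2 + \<parallel>b\<parallel>\<^sup>2) / 4\<close>, and for \<open>x\<close>, \<open>y\<close> equal up to a phase the last factor is
  a quadratic form of \<open>|B|\<^bsup>2t\<^esup> + |A\<^sup>*|\<^bsup>2(1-t)\<^esup>\<close>.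

  The functional calculus rests on \<open>\<parallel>p(T)\<parallel> \<le> sup |p|\<close> over the spectrum of a self-adjoint \<open>T\<close>:
  for \<open>N = \<parallel>p(T)\<parallel>\<close> the operator \<open>(p\<^sup>2 - N\<^sup>2)(T)\<close> is not bounded below, so \<open>p\<^sup>2 - N\<^sup>2\<close>
  has a real root in the spectrum; the irreducible quadratic factors are always
  bounded below at \<open>T\<close>.
\<close>

section \<open>Adjoints\<close>

\<comment> \<open>Makes the bounded operators a Banach space, which later supplies limits for Cauchy
  sequences of polynomials in an operator.\<close>
subclass (in complex_hilbert) banach ..

lemma inner_scaleC_left: "inner (c *\<^sub>C x) y = inner x (cnj c *\<^sub>C y)"
  for x y :: "'a::complex_inner"
proof -
  have "cinner x (cnj c *\<^sub>C y) = cnj (cnj c * cinner y x)"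
    by (metis cinner_commute cinner_scaleC_left)
  also have "\<dots> = c * cinner x y"
    by (metis cinner_commute complex_cnj_cnj complex_cnj_mult)
  finally show ?thesis
    by (metis Re_cinner cinner_scaleC_left)
qed

text \<open>Moving c across the real form produces \<open>cnj c * c\<close>, the real scalar
  |c|^2.\<close>

lemma norm_scaleC: "norm (c *\<^sub>C x) = cmod c * norm x"
  for x :: "'a::complex_inner"
proof -
  have "inner (c *\<^sub>C x) (c *\<^sub>C x) = inner x (complex_of_real ((cmod c)\<^sup>2) *\<^sub>C x)"
    by (simp only: inner_scaleC_left scaleC_scaleC complex_norm_square mult.commute)
  also have "\<dots> = (cmod c * norm x)\<^sup>2"
    by (simp add: scaleC_of_real dot_square_norm power_mult_distrib del: of_real_power)
  finally have "(norm (c *\<^sub>C x))\<^sup>2 = (cmod c * norm x)\<^sup>2"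
    by (simp add: dot_square_norm)
  then show ?thesis
    by simp
qed

text \<open>The hypothesis says Re (c z) = Re (c z') for every c: c = 1 compares real parts and c =
  -i imaginary parts. Computations with the real form \<open>inner\<close> thus settle complex
  identities.\<close>

lemma cinner_eqI:
  fixes x y x' y' :: "'a::complex_inner"
  assumes "\<And>c. inner (c *\<^sub>C x) y = inner (c *\<^sub>C x') y'"
  shows "cinner x y = cinner x' y'"
proof (rule complex_eqI)
  have Re: "inner (c *\<^sub>C x) y = Re (c * cinner x y)" for c and x y :: 'a
    by (metis Re_cinner cinner_scaleC_left)
  show "Re (cinner x y) = Re (cinner x' y')"
    using assms[of 1, unfolded Re] by simp
  show "Im (cinner x y) = Im (cinner x' y')"
    using assms[of "- \<i>", unfolded Re] by simp
qed

lemma scaleC_diff_right: "c *\<^sub>C (x - y) = c *\<^sub>C x - c *\<^sub>C (y :: 'a::complex_vector)"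
  using scaleC_add_right[of c "x - y" y] by (simp add: algebra_simps)

lemma bounded_linear_scaleC: "bounded_linear (\<lambda>x. c *\<^sub>C x :: 'a::complex_inner)"
proof (rule bounded_linear_intro)
  show "c *\<^sub>C (r *\<^sub>R x) = r *\<^sub>R c *\<^sub>C x" for r and x :: 'a
    by (metis scaleC_of_real scaleC_scaleC mult.commute)
  show "norm (c *\<^sub>C x) \<le> norm x * cmod c" for x :: 'a
    by (simp add: norm_scaleC)
qed (rule scaleC_add_right)

lemma scaleC_minus_right: "c *\<^sub>C (- x) = - (c *\<^sub>C x)" for x :: "'a::complex_inner"
  by (rule linear_neg[OF bounded_linear.linear[OF bounded_linear_scaleC]])

text \<open>The representing vector is the minimizer of \<open>inner x x - 2 * \<phi> x\<close>,
  which exists by completeness.\<close>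

lemma riesz_representation:
  fixes \<phi> :: "'a::{real_inner, complete_space} \<Rightarrow> real"
  assumes "bounded_linear \<phi>"
  obtains u where "\<And>x. \<phi> x = inner x u"
proof -
  interpret \<phi>: bounded_linear \<phi> by fact
  obtain K where K: "\<And>x. \<bar>\<phi> x\<bar> \<le> norm x * K"
    using \<phi>.bounded by auto
  define J where "J x = inner x x - 2 * \<phi> x" for x
  have J_lower: "- (K * K) \<le> J x" for x
  proof -
    have "0 \<le> (norm x - K) * (norm x - K)" by simp
    then show ?thesis
      using K[of x] by (auto simp: J_def dot_square_norm power2_eq_square algebra_simps)
  qed
  then have bdd: "bdd_below (range J)"
    by (auto simp: bdd_below_def)
  define m where "m = Inf (range J)"
  have m_le: "m \<le> J x" for x
    unfolding m_def using bdd by (simp add: cInf_lower)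
  have "\<exists>x. J x < m + inverse (real (Suc n))" for n
    using cInf_lessD[of "range J" "m + inverse (real (Suc n))"] by (auto simp: m_def)
  then obtain X where X: "\<And>n. J (X n) < m + inverse (real (Suc n))"
    by metis
  \<comment> \<open>The parallelogram identity compares x and y with their midpoint, where J is at
    least m; this makes minimizing sequences Cauchy.\<close>
  have par: "inner (x - y) (x - y) \<le> 2 * (J x - m) + 2 * (J y - m)" for x y
  proof -
    have "inner (x - y) (x - y) = 2 * J x + 2 * J y - 4 * J ((1/2) *\<^sub>R (x + y))"
      by (simp add: J_def \<phi>.scaleR \<phi>.add inner_commute algebra_simps)
    then show ?thesis using m_le[of "(1/2) *\<^sub>R (x + y)"] by simp
  qed
  have "Cauchy X"
  proof (rule metric_CauchyI)
    fix e :: real assume e: "0 < e"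
    then obtain N where N: "inverse (real (Suc N)) < e\<^sup>2 / 4"
      using reals_Archimedean[of "e\<^sup>2 / 4"] by auto
    have *: "J (X n) - m < e\<^sup>2 / 4" if "n \<ge> N" for n
    proof -
      have "inverse (real (Suc n)) \<le> inverse (real (Suc N))"
        using that by (intro le_imp_inverse_le) auto
      then show ?thesis using X[of n] N by linarith
    qed
    show "\<exists>N. \<forall>i\<ge>N. \<forall>j\<ge>N. dist (X i) (X j) < e"
    proof (intro exI allI impI)
      fix i j assume "i \<ge> N" "j \<ge> N"
      then have "(norm (X i - X j))\<^sup>2 < e\<^sup>2"
        using par[of "X i" "X j"] *[of i] *[of j] by (simp add: dot_square_norm)
      then show "dist (X i) (X j) < e"
        using e by (simp add: dist_norm power_less_imp_less_base)
    qed
  qed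
  then obtain u where u: "X \<longlonglongrightarrow> u"
    using Cauchy_convergent convergent_def by blast
  have "(\<lambda>n. J (X n)) \<longlonglongrightarrow> J u"
    unfolding J_def by (intro tendsto_intros u \<phi>.tendsto)
  moreover have "(\<lambda>n. m + inverse (real (Suc n))) \<longlonglongrightarrow> m + 0"
    by (intro tendsto_intros LIMSEQ_inverse_real_of_nat)
  ultimately have "J u \<le> m"
    using LIMSEQ_le[of "\<lambda>n. J (X n)" "J u" "\<lambda>n. m + inverse (real (Suc n))" m] X
    by (force intro: less_imp_le)
  then have Ju: "J u \<le> J x" for x
    using m_le[of x] by simp
  have "\<phi> z = inner z u" for z
  proof (rule ccontr)
    define d where "d = inner z u - \<phi> z"
    assume "\<phi> z \<noteq> inner z u"
    then have d: "d \<noteq> 0" by (simp add: d_def)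
    then have z: "z \<noteq> 0" by (auto simp: d_def \<phi>.zero)
    have "J (u + t *\<^sub>R z) = J u + 2 * t * d + t\<^sup>2 * inner z z" for t
      by (simp add: J_def d_def \<phi>.scaleR \<phi>.add inner_commute algebra_simps power2_eq_square)
    then have "0 \<le> 2 * t * d + t\<^sup>2 * inner z z" for t
      using Ju[of "u + t *\<^sub>R z"] by simp
    \<comment> \<open>This t minimizes the quadratic in t; the minimum is - d^2 /
      \<open>inner z z\<close>, negative unless d = 0.\<close>
    from this[of "- d / inner z z"] have "d\<^sup>2 / inner z z \<le> 0"
      using z by (simp add: power2_eq_square field_simps)
    moreover have "d\<^sup>2 / inner z z > 0"
      using d z by simp
    ultimately show False by simp
  qed
  then show ?thesis using that by blast
qed

lemma inner_eqI:
  fixes x y :: "'a::real_inner"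
  assumes "\<And>z. inner z x = inner z y"
  shows "x = y"
proof -
  have "inner (x - y) (x - y) = 0"
    using assms[of "x - y"] by (simp add: inner_diff_right)
  then show ?thesis by simp
qed

text \<open>Complex linearity of T upgrades the real adjoint relation to the complex one through
  \<open>cinner_eqI\<close>; uniqueness follows from real parts alone.\<close>

lemma adj_unique:
  fixes S T :: "'a::complex_inner \<Rightarrow>\<^sub>L 'a"
  assumes "clinear_op S" "\<And>x y. inner (T x) y = inner x (S y)"
    and "clinear_op T"
  shows "adj T = S"
  unfolding adj_def
proof (rule the_equality)
  show "clinear_op S \<and> (\<forall>x y. cinner (T x) y = cinner x (S y))"
    using assms by (auto intro!: cinner_eqI simp flip: assms(2) simp: clinear_op_def)
next
  fix S' assume "clinear_op S' \<and> (\<forall>x y. cinner (T x) y = cinner x (S' y))"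
  then show "S' = S"
    by (metis Re_cinner assms(2) blinfun_eqI inner_eqI)
qed

text \<open>Riesz representation of the functional \<open>inner (T x) y\<close> of x gives the
  adjoint vector \<open>s y\<close>. The map s inherits complex linearity from T because
  multiplication by c has real adjoint multiplication by \<open>cnj c\<close>.\<close>

lemma
  fixes T :: "'a::complex_hilbert \<Rightarrow>\<^sub>L 'a"
  assumes T: "clinear_op T"
  shows clinear_op_adj: "clinear_op (adj T)"
    and inner_adj: "inner (T x) y = inner x (adj T y)"
proof -
  have "\<exists>u. \<forall>x. inner (T x) y = inner x u" for y
    using riesz_representation[of "\<lambda>x. inner (T x) y"]
      bounded_linear_compose[OF bounded_linear_inner_left blinfun.bounded_linear_right] by metis
  then obtain s where s: "\<And>x y. inner (T x) y = inner x (s y)"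
    by metis
  have "bounded_linear s"
  proof (rule bounded_linear_intro)
    show "s (x + y) = s x + s y" for x y
      by (rule inner_eqI) (simp add: inner_add_right flip: s)
    show "s (r *\<^sub>R x) = r *\<^sub>R s x" for r x
      by (rule inner_eqI) (simp flip: s)
    show "norm (s x) \<le> norm x * norm T" for x
    proof -
      have "(norm (s x))\<^sup>2 = inner (T (s x)) x"
        by (simp add: s dot_square_norm)
      also have "\<dots> \<le> norm (T (s x)) * norm x"
        by (rule norm_cauchy_schwarz)
      also have "\<dots> \<le> norm T * norm (s x) * norm x"
        by (intro mult_right_mono norm_blinfun norm_ge_zero)
      finally have "norm (s x) * norm (s x) \<le> norm (s x) * (norm x * norm T)"
        by (simp add: power2_eq_square mult_ac)
      then show ?thesis
        by (cases "norm (s x) = 0") (auto simp: mult_le_cancel_left simp del: norm_eq_zero)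
    qed
  qed
  then obtain S where S: "\<And>y. blinfun_apply S y = s y"
    using bounded_linear_Blinfun_apply by metis
  have "clinear_op S"
    unfolding clinear_op_def
  proof (intro allI, rule inner_eqI)
    fix c x z
    have "inner z (S (c *\<^sub>C x)) = inner (c *\<^sub>C x) (T z)"
      by (simp add: S inner_commute flip: s)
    also have "\<dots> = inner x (T (cnj c *\<^sub>C z))"
      using T by (simp add: inner_scaleC_left clinear_op_def)
    also have "\<dots> = inner (cnj c *\<^sub>C z) (S x)"
      by (metis S s inner_commute)
    finally show "inner z (S (c *\<^sub>C x)) = inner z (c *\<^sub>C S x)"
      by (simp add: inner_scaleC_left)
  qed
  moreover have TS: "inner (T x) y = inner x (S y)" for x y
    by (simp add: s S)
  ultimately have "adj T = S"
    using T by (rule adj_unique)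
  with \<open>clinear_op S\<close> TS show "clinear_op (adj T)" "inner (T x) y = inner x (adj T y)"
    by simp_all
qed

lemma adj_adj:
  fixes T :: "'a::complex_hilbert \<Rightarrow>\<^sub>L 'a"
  assumes "clinear_op T"
  shows "adj (adj T) = T"
proof (rule adj_unique)
  show "inner (adj T x) y = inner x (T y)" for x y
    by (metis assms inner_adj inner_commute)
qed (simp_all add: assms clinear_op_adj)

section \<open>Polynomials of self-adjoint operators\<close>

lemma poly_op_apply: "poly_op p T x = (\<Sum>i\<le>degree p. coeff p i *\<^sub>R (blinfun_apply T ^^ i) x)"
proof -
  have "(((o\<^sub>L) T ^^ i) id_blinfun) x = (blinfun_apply T ^^ i) x" for i
    by (induction i) auto
  then show ?thesis
    by (simp add: poly_op_def blinfun.sum_left blinfun.scaleR_left)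
qed

lemma poly_op_0: "poly_op 0 T = 0"
  by (rule blinfun_eqI) (simp add: poly_op_apply)

lemma poly_op_pCons: "poly_op (pCons a p) T = a *\<^sub>R id_blinfun + (T o\<^sub>L poly_op p T)"
proof (rule blinfun_eqI)
  fix x
  show "poly_op (pCons a p) T x = (a *\<^sub>R id_blinfun + (T o\<^sub>L poly_op p T)) x"
  proof (cases "p = 0")
    case True
    then show ?thesis by (simp add: poly_op_apply blinfun.bilinear_simps)
  next
    case False
    then have "poly_op (pCons a p) T x
        = a *\<^sub>R x + (\<Sum>i\<le>degree p. coeff p i *\<^sub>R T ((blinfun_apply T ^^ i) x))"
      by (simp add: poly_op_apply sum.atMost_Suc_shift del: sum.atMost_Suc)
    then show ?thesis
      by (simp add: poly_op_apply blinfun.bilinear_simps blinfun.sum_right)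
  qed
qed

lemma poly_op_pCons_apply: "poly_op (pCons a p) T x = a *\<^sub>R x + T (poly_op p T x)"
  by (simp add: poly_op_pCons blinfun.bilinear_simps)

lemma poly_op_add: "poly_op (p + q) T = poly_op p T + poly_op q T"
proof (rule blinfun_eqI)
  show "poly_op (p + q) T x = (poly_op p T + poly_op q T) x" for x
    by (induction p q rule: poly_induct2)
      (simp_all add: poly_op_0 poly_op_pCons_apply blinfun.bilinear_simps algebra_simps)
qed

lemma poly_op_smult: "poly_op (smult c p) T = c *\<^sub>R poly_op p T"
proof (rule blinfun_eqI)
  show "poly_op (smult c p) T x = (c *\<^sub>R poly_op p T) x" for x
    by (induction p)
      (simp_all add: poly_op_0 poly_op_pCons_apply blinfun.bilinear_simps algebra_simps)
qed

lemma poly_op_diff: "poly_op (p - q) T = poly_op p T - poly_op q T"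
  using poly_op_add[of p "- q" T] poly_op_smult[of "- 1" q T] by simp

lemma poly_op_mult: "poly_op (p * q) T = poly_op p T o\<^sub>L poly_op q T"
proof (rule blinfun_eqI)
  show "poly_op (p * q) T x = (poly_op p T o\<^sub>L poly_op q T) x" for x
    by (induction p)
      (simp_all add: poly_op_0 poly_op_pCons_apply poly_op_add poly_op_smult blinfun.bilinear_simps)
qed

text \<open>Two uses: with all three operators equal to T, it says that T commutes with its
  polynomials; with B, \<open>adj B o\<^sub>L B\<close> and \<open>B o\<^sub>L adj B\<close>, it
  carries functions of one product across B to the other.\<close>

lemma poly_op_intertwine:
  fixes B :: "'a::real_normed_vector \<Rightarrow>\<^sub>L 'b::real_normed_vector"
    and S :: "'a \<Rightarrow>\<^sub>L 'a" and T :: "'b \<Rightarrow>\<^sub>L 'b"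
  assumes "\<And>x. B (S x) = T (B x)"
  shows "B (poly_op p S x) = poly_op p T (B x)"
  by (induction p) (simp_all add: poly_op_0 poly_op_pCons_apply blinfun.bilinear_simps assms)

lemma poly_op_symmetric:
  fixes T :: "'a::real_inner \<Rightarrow>\<^sub>L 'a"
  assumes "\<And>x y. inner (T x) y = inner x (T y)"
  shows "inner (poly_op p T x) y = inner x (poly_op p T y)"
proof (induction p arbitrary: x y)
  case (pCons a p)
  have "poly_op p T (T y) = T (poly_op p T y)" for y
    by (rule poly_op_intertwine[symmetric]) simp
  then show ?case
    by (simp add: poly_op_pCons_apply inner_add_left inner_add_right assms pCons)
qed (simp add: poly_op_0)

lemma clinear_op_poly_op: "clinear_op T \<Longrightarrow> clinear_op (poly_op p T)"
  for T :: "'a::complex_inner \<Rightarrow>\<^sub>L 'a"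
proof (induction p)
  case 0
  show ?case
    by (simp add: clinear_op_def poly_op_0 linear_0[OF bounded_linear.linear[OF bounded_linear_scaleC]])
next
  case (pCons a p)
  moreover have "a *\<^sub>R c *\<^sub>C x = c *\<^sub>C a *\<^sub>R x" for c and x :: 'a
    by (rule linear_scale[OF bounded_linear.linear[OF bounded_linear_scaleC], symmetric])
  ultimately show ?case
    by (simp add: clinear_op_def poly_op_pCons_apply scaleC_add_right)
qed

section \<open>Norm of a polynomial in a self-adjoint operator, bounded over the spectrum\<close>

lemma map_poly_of_real_add:
  "map_poly complex_of_real (p + q) = map_poly of_real p + map_poly of_real q"
  by (simp add: poly_eq_iff coeff_map_poly)

lemma map_poly_of_real_mult:
  "map_poly complex_of_real (p * q) = map_poly of_real p * map_poly of_real q"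
  by (induction p) (simp_all add: map_poly_of_real_add map_poly_smult map_poly_pCons)

text \<open>Take a complex root a + ib. If b = 0 it gives a linear factor. Otherwise divide by (X -
  a)^2 + b^2: the remainder is real of degree below 2 and vanishes at a non-real point, hence is
  zero.\<close>

lemma real_poly_irreducible_factor:
  fixes q :: "real poly"
  assumes "degree q > 0"
  obtains (linear) a r where "q = [:- a, 1:] * r"
  | (quadratic) a b r where "b \<noteq> 0" "q = [:a\<^sup>2 + b\<^sup>2, - 2 * a, 1:] * r"
proof -
  have "degree (map_poly complex_of_real q) > 0"
    using assms by (simp add: degree_map_poly)
  then obtain z where z: "poly (map_poly complex_of_real q) z = 0"
    using alg_closed_imp_poly_has_root by blast
  define a b where "a = Re z" and "b = Im z"
  have z_eq: "z = Complex a b" by (simp add: a_def b_def)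
  show thesis
  proof (cases "b = 0")
    case True
    have "poly (map_poly complex_of_real p) (of_real a) = of_real (poly p a)" for p
      by (induction p) (simp_all add: map_poly_pCons)
    then have "poly q a = 0"
      using z z_eq True by (simp add: complex_eq_iff flip: complex_of_real_def)
    then show ?thesis
      by (metis linear dvdE poly_eq_0_iff_dvd)
  next
    case False
    define d where "d = [:a\<^sup>2 + b\<^sup>2, - 2 * a, 1:]"
    define e where "e = q mod d"
    have "degree e < 2"
      using degree_mod_less[of d q] by (auto simp: d_def e_def)
    then obtain e0 e1 where e: "e = [:e0, e1:]"
      by (intro that[of "coeff e 0" "coeff e 1"] poly_eqI)
        (auto simp: coeff_pCons coeff_eq_0 split: nat.splits)
    have "poly (map_poly complex_of_real d) z = 0"
      by (simp add: d_def z_eq map_poly_pCons complex_eq_iff power2_eq_square algebra_simps)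
    moreover have "q = d * (q div d) + e"
      by (simp add: e_def)
    then have "poly (map_poly complex_of_real q) z = poly (map_poly complex_of_real d) z *
        poly (map_poly complex_of_real (q div d)) z + poly (map_poly complex_of_real e) z"
      by (metis map_poly_of_real_add map_poly_of_real_mult poly_add poly_mult)
    ultimately have "poly (map_poly complex_of_real e) z = 0"
      using z by simp
    then have "e = 0"
      using False by (auto simp: e z_eq map_poly_pCons complex_eq_iff)
    then have "q = d * (q div d)"
      using \<open>q = d * (q div d) + e\<close> by simp
    then show ?thesis
      using False quadratic d_def by blast
  qed
qed

text \<open>A bounded left inverse S gives a lower bound of the order of its inverse norm;
  \<open>+ 1\<close> avoids division by zero on the zero space.\<close>

lemma bounded_below_of_not_spectrum:
  assumes "complex_of_real a \<notin> spectrum T"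
  obtains c where "c > 0" "\<And>x. c * norm x \<le> norm (T x - a *\<^sub>R x)"
proof -
  obtain S where S: "\<And>x. blinfun_apply S (T x - complex_of_real a *\<^sub>C x) = x"
    using assms unfolding spectrum_def by blast
  have "1 / (norm S + 1) * norm x \<le> norm (T x - a *\<^sub>R x)" for x
  proof -
    have "norm x \<le> norm S * norm (T x - a *\<^sub>R x)"
      using norm_blinfun[of S "T x - a *\<^sub>R x"] S[of x] by (simp add: scaleC_of_real)
    also have "\<dots> \<le> (norm S + 1) * norm (T x - a *\<^sub>R x)"
      by (simp add: mult_right_mono)
    finally show ?thesis
      by (simp add: divide_le_eq add_nonneg_pos mult.commute)
  qed
  moreover have "1 / (norm S + 1) > 0"
    by (simp add: add_nonneg_pos)
  ultimately show thesis using that by blast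
qed

text \<open>Induction on the degree, splitting off one irreducible factor at a time. A linear factor
  has its root off the spectrum; a quadratic one is bounded below by symmetry of T.\<close>

lemma poly_op_bounded_below:
  fixes T :: "'a::complex_inner \<Rightarrow>\<^sub>L 'a"
  assumes sym: "\<And>x y. inner (T x) y = inner x (T y)"
    and "q \<noteq> 0" and "\<And>a. complex_of_real a \<in> spectrum T \<Longrightarrow> poly q a \<noteq> 0"
  shows "\<exists>c>0. \<forall>x. c * norm x \<le> norm (poly_op q T x)"
  using assms(2,3)
proof (induction "degree q" arbitrary: q rule: less_induct)
  case less
  \<comment> \<open>Lower bounds multiply under composition: d is the factor split off, and the
    induction hypothesis covers r.\<close>
  have step: ?case if q: "q = d * r" and deg: "degree d > 0" and "c > 0"
    and d: "\<And>x. c * norm x \<le> norm (poly_op d T x)" for d r c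
  proof -
    have "d \<noteq> 0" "r \<noteq> 0" using less q by auto
    then have "degree r < degree q"
      using q deg by (simp add: degree_mult_eq)
    then obtain c' where "c' > 0" and r: "\<And>x. c' * norm x \<le> norm (poly_op r T x)"
      using less.hyps[of r] less.prems q \<open>r \<noteq> 0\<close> by auto
    have "c * c' * norm x \<le> norm (poly_op q T x)" for x
    proof -
      have "c * c' * norm x \<le> c * norm (poly_op r T x)"
        using r[of x] \<open>c > 0\<close> by (simp add: mult.assoc)
      also have "\<dots> \<le> norm (poly_op q T x)"
        using d[of "poly_op r T x"] by (simp add: q poly_op_mult)
      finally show ?thesis .
    qed
    then show ?thesis
      using \<open>c > 0\<close> \<open>c' > 0\<close> by (intro exI[of _ "c * c'"]) simp
  qed
  show ?case
  proof (cases "degree q > 0")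
    case True
    then show ?thesis
    proof (cases rule: real_poly_irreducible_factor)
      case (linear a r)
      then have "complex_of_real a \<notin> spectrum T"
        using less.prems by auto
      then obtain c where "c > 0" "\<And>x. c * norm x \<le> norm (T x - a *\<^sub>R x)"
        using bounded_below_of_not_spectrum by blast
      then show ?thesis
        using step[OF linear] by (simp add: poly_op_pCons_apply poly_op_0 blinfun.bilinear_simps)
    next
      case (quadratic a b r)
      let ?d = "[:a\<^sup>2 + b\<^sup>2, - 2 * a, 1:]"
      have "b\<^sup>2 * norm x \<le> norm (poly_op ?d T x)" for x
      proof (cases "x = 0")
        case False
        have eq: "poly_op ?d T x = T (T x) - (2 * a) *\<^sub>R T x + (a\<^sup>2 + b\<^sup>2) *\<^sub>R x"
          by (simp add: poly_op_pCons_apply poly_op_0 blinfun.bilinear_simps)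
        \<comment> \<open>Completing the square: the factor is (T - a)^2 + b^2, and T - a is
          symmetric.\<close>
        have "inner (poly_op ?d T x) x = inner (T x - a *\<^sub>R x) (T x - a *\<^sub>R x) + b\<^sup>2 * inner x x"
          unfolding eq
          by (simp add: sym inner_add_left inner_diff_left inner_diff_right inner_commute
              power2_eq_square algebra_simps)
        then have "b\<^sup>2 * inner x x \<le> inner (poly_op ?d T x) x"
          by simp
        also have "\<dots> \<le> norm (poly_op ?d T x) * norm x"
          by (rule norm_cauchy_schwarz)
        finally show ?thesis
          using False by (simp add: dot_square_norm power2_eq_square)
      qed simp
      then show ?thesis
        using step[OF quadratic(2), of "b\<^sup>2"] quadratic(1) by simp
    qed
  next
    case False
    then obtain a where "q = [:a:]"
      by (metis degree_eq_zeroE gr0I)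
    then show ?thesis
      using less.prems
      by (intro exI[of _ "\<bar>a\<bar>"]) (simp add: poly_op_pCons_apply poly_op_0 blinfun.bilinear_simps)
  qed
qed

text \<open>Otherwise p^2 - N^2 has no root in the spectrum, so its value at T is bounded below, and
  this pushes the norm of S = p(T) strictly below N. The hypothesis \<open>ne\<close> keeps p^2 -
  N^2 from being the zero polynomial.\<close>

lemma spectrum_attains_norm:
  fixes T :: "'a::complex_inner \<Rightarrow>\<^sub>L 'a"
  assumes sym: "\<And>x y. inner (T x) y = inner x (T y)" and "z \<noteq> (0::'a)"
    and ne: "p * p \<noteq> [:(norm (poly_op p T))\<^sup>2:]"
  obtains a where "complex_of_real a \<in> spectrum T" "\<bar>poly p a\<bar> = norm (poly_op p T)"
proof (rule ccontr)
  define S N where "S = poly_op p T" and "N = norm S"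
  assume "\<not> thesis"
  then have "\<bar>poly p a\<bar> \<noteq> N" if "complex_of_real a \<in> spectrum T" for a
    using \<open>\<And>a. _ \<Longrightarrow> _ \<Longrightarrow> thesis\<close> that by (auto simp: S_def N_def)
  then have "poly (p * p - [:N\<^sup>2:]) a \<noteq> 0" if "complex_of_real a \<in> spectrum T" for a
    using that by (auto simp: N_def simp flip: power2_eq_square dest!: power2_eq_imp_eq[of "\<bar>poly p a\<bar>", simplified])
  moreover have "p * p - [:N\<^sup>2:] \<noteq> 0"
    using ne by (simp add: S_def N_def)
  ultimately obtain c where c: "c > 0"
    and below: "\<And>x. c * norm x \<le> norm (poly_op (p * p - [:N\<^sup>2:]) T x)"
    using poly_op_bounded_below[OF sym] by metis
  have symS: "inner (S x) y = inner x (S y)" for x y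
    unfolding S_def using sym by (rule poly_op_symmetric)
  \<comment> \<open>Expand the square of the norm of S S x - N^2 x and bound the norm of S S x by
    N^2 times that of x.\<close>
  have key: "c\<^sup>2 * (norm x)\<^sup>2 + 2 * N\<^sup>2 * (norm (S x))\<^sup>2 \<le> 2 * N^4 * (norm x)\<^sup>2" for x
  proof -
    have "(c * norm x)\<^sup>2 \<le> (norm (poly_op (p * p - [:N\<^sup>2:]) T x))\<^sup>2"
      using below[of x] c by (intro power_mono) auto
    also have "poly_op (p * p - [:N\<^sup>2:]) T x = S (S x) - N\<^sup>2 *\<^sub>R x"
      by (simp add: poly_op_diff poly_op_mult poly_op_pCons_apply poly_op_0 S_def
          blinfun.bilinear_simps)
    also have "(norm (S (S x) - N\<^sup>2 *\<^sub>R x))\<^sup>2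
        = (norm (S (S x)))\<^sup>2 - 2 * N\<^sup>2 * (norm (S x))\<^sup>2 + N^4 * (norm x)\<^sup>2"
      by (simp add: symS inner_diff_left inner_diff_right inner_commute power4_eq_xxxx
          power2_eq_square[of N] algebra_simps flip: dot_square_norm)
    also have "(norm (S (S x)))\<^sup>2 \<le> (N * (N * norm x))\<^sup>2"
      unfolding N_def by (intro power_mono order_trans[OF norm_blinfun] mult_left_mono norm_blinfun) auto
    finally show ?thesis
      by (simp add: power_mult_distrib power4_eq_xxxx power2_eq_square[of N])
  qed
  have "N > 0"
    using key[of z] c \<open>z \<noteq> 0\<close> by (cases "N = 0") (auto simp: N_def mult_le_0_iff)
  \<comment> \<open>The constant left after dividing \<open>key\<close> by 2 N^2; it is strictly
    smaller than N^2.\<close>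
  define b where "b = N\<^sup>2 - c\<^sup>2 / (2 * N\<^sup>2)"
  have le_b: "(norm (S x))\<^sup>2 \<le> b * (norm x)\<^sup>2" for x
    using key[of x] \<open>N > 0\<close> by (simp add: b_def field_simps power2_eq_square power4_eq_xxxx)
  have "0 \<le> b * (norm z)\<^sup>2"
    using le_b[of z] by (meson order_trans zero_le_power2)
  then have "b \<ge> 0"
    using \<open>z \<noteq> 0\<close> by (simp add: zero_le_mult_iff)
  have "norm (S x) \<le> sqrt b * norm x" for x
    using real_sqrt_le_mono[OF le_b[of x]] by (simp add: real_sqrt_mult)
  then have "N \<le> sqrt b"
    unfolding N_def using \<open>b \<ge> 0\<close> by (intro norm_blinfun_bound) auto
  then have "N\<^sup>2 \<le> b"
    using \<open>N > 0\<close> \<open>b \<ge> 0\<close> by (metis less_imp_le power_mono real_sqrt_pow2)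
  then show False
    using c \<open>N > 0\<close> by (simp add: b_def divide_le_0_iff)
qed

text \<open>Usually the norm is attained as |p(a)| on the spectrum. If p^2 is the constant N^2, then
  |p| = N everywhere and any real spectral point will do. On the zero space every operator has norm
  0.\<close>

lemma norm_poly_op_le:
  fixes T :: "'a::complex_inner \<Rightarrow>\<^sub>L 'a"
  assumes sym: "\<And>x y. inner (T x) y = inner x (T y)" and "M \<ge> 0"
    and M: "\<And>a. complex_of_real a \<in> spectrum T \<Longrightarrow> \<bar>poly p a\<bar> \<le> M"
  shows "norm (poly_op p T) \<le> M"
proof (cases "\<exists>z::'a. z \<noteq> 0")
  case True
  then obtain z :: 'a where "z \<noteq> 0" by blast
  show ?thesis
  proof (cases "p * p = [:(norm (poly_op p T))\<^sup>2:]")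
    case True
    \<comment> \<open>The square of the polynomial X is not constant, so applying the previous lemma
      to X yields a real spectral point.\<close>
    obtain a where a: "complex_of_real a \<in> spectrum T"
      by (rule spectrum_attains_norm[OF sym \<open>z \<noteq> 0\<close>, of "[:0, 1:]"]) auto
    have "(poly p a)\<^sup>2 = (norm (poly_op p T))\<^sup>2"
      using arg_cong[OF True, of "\<lambda>p. poly p a"] by (simp add: power2_eq_square)
    then have "\<bar>poly p a\<bar> = norm (poly_op p T)"
      by (metis abs_norm_cancel power2_eq_iff abs_minus)
    then show ?thesis using M[OF a] by simp
  next
    case False
    then show ?thesis
      using spectrum_attains_norm[OF sym \<open>z \<noteq> 0\<close>] M by metis
  qed
next
  case False
  then show ?thesis
    using \<open>M \<ge> 0\<close> by (intro norm_blinfun_bound) (simp, metis blinfun.zero_right norm_zero mult_zero_right order_refl)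
qed

section \<open>Positive operators\<close>

text \<open>Lax-Milgram argument: for a suitable \<alpha> the map sending x to x - \<alpha> (R x -
  y) is a contraction, and its fixed point solves R x = y. Coercivity bounds the inverse by 1 /
  d.\<close>

lemma coercive_invertible:
  fixes R :: "'a::complex_hilbert \<Rightarrow>\<^sub>L 'a"
  assumes R: "clinear_op R" and "d > 0" and coercive: "\<And>x. d * (norm x)\<^sup>2 \<le> inner (R x) x"
  obtains S where "clinear_op S" "\<And>x. blinfun_apply S (R x) = x" "\<And>x. R (blinfun_apply S x) = x"
proof -
  have below: "d * norm x \<le> norm (R x)" for x
  proof (cases "x = 0")
    case False
    have "d * (norm x)\<^sup>2 \<le> norm (R x) * norm x"
      using coercive[of x] norm_cauchy_schwarz[of "R x" x] by linarith
    then show ?thesis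
      using False by (simp add: power2_eq_square)
  qed simp
  have inj: "x = y" if "R x = R y" for x y
    using below[of "x - y"] that \<open>d > 0\<close> by (simp add: blinfun.diff_right mult_le_0_iff)
  \<comment> \<open>M bounds the norm of R and is positive and at least d, so that 1 - d^2 / M^2
    lies in [0, 1).\<close>
  define M where "M = norm R + d"
  have M: "M > 0" "d \<le> M" "norm R \<le> M"
    using \<open>d > 0\<close> by (auto simp: M_def add_nonneg_pos)
  define k where "k = sqrt (1 - d\<^sup>2 / M\<^sup>2)"
  have dM: "0 < d\<^sup>2 / M\<^sup>2" "d\<^sup>2 / M\<^sup>2 \<le> 1"
    using M \<open>d > 0\<close> by (auto intro: power_mono)
  then have k: "0 \<le> k" "k < 1" "k\<^sup>2 = 1 - d\<^sup>2 / M\<^sup>2"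
    by (auto simp: k_def)
  \<comment> \<open>The minimizer of 1 - 2 \<alpha> d + \<alpha>^2 M^2, with minimum k^2.\<close>
  define \<alpha> where "\<alpha> = d / M\<^sup>2"
  have contraction: "norm (x - \<alpha> *\<^sub>R R x) \<le> k * norm x" for x
  proof -
    have "(norm (x - \<alpha> *\<^sub>R R x))\<^sup>2 = (norm x)\<^sup>2 - 2 * \<alpha> * inner (R x) x + \<alpha>\<^sup>2 * (norm (R x))\<^sup>2"
      by (simp add: inner_diff_left inner_diff_right inner_commute power2_eq_square[of \<alpha>]
          algebra_simps flip: dot_square_norm)
    also have "\<dots> \<le> (norm x)\<^sup>2 - 2 * \<alpha> * (d * (norm x)\<^sup>2) + \<alpha>\<^sup>2 * (M * norm x)\<^sup>2"
    proof (intro add_mono diff_mono mult_left_mono power_mono coercive)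
      show "norm (R x) \<le> M * norm x"
        using M(3) by (meson mult_right_mono norm_blinfun norm_ge_zero order_trans)
    qed (use \<open>d > 0\<close> M(1) in \<open>auto simp: \<alpha>_def\<close>)
    also have "\<dots> = (1 - d\<^sup>2 / M\<^sup>2) * (norm x)\<^sup>2"
      using M(1) by (simp add: \<alpha>_def power_mult_distrib power2_eq_square field_simps)
    also have "\<dots> = k\<^sup>2 * (norm x)\<^sup>2"
      by (simp only: k(3))
    finally have "(norm (x - \<alpha> *\<^sub>R R x))\<^sup>2 \<le> (k * norm x)\<^sup>2"
      by (simp add: power_mult_distrib)
    then show ?thesis
      by (rule power2_le_imp_le) (simp add: k(1))
  qed
  have surj: "\<exists>x. R x = y" for y
  proof -
    have "\<exists>!x. x - \<alpha> *\<^sub>R (R x - y) = x"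
    proof (rule banach_fix_type[OF k(1,2)], intro allI)
      fix x x'
      have "x - \<alpha> *\<^sub>R (R x - y) - (x' - \<alpha> *\<^sub>R (R x' - y)) = (x - x') - \<alpha> *\<^sub>R R (x - x')"
        by (simp add: blinfun.diff_right algebra_simps)
      then show "dist (x - \<alpha> *\<^sub>R (R x - y)) (x' - \<alpha> *\<^sub>R (R x' - y)) \<le> k * dist x x'"
        using contraction[of "x - x'"] by (simp only: dist_norm)
    qed
    moreover have "\<alpha> \<noteq> 0"
      using \<open>d > 0\<close> M(1) by (simp add: \<alpha>_def)
    ultimately show ?thesis by auto
  qed
  then obtain s where s: "\<And>y. R (s y) = y"
    by metis
  have "bounded_linear s"
  proof (rule bounded_linear_intro)
    show "s (x + y) = s x + s y" for x y
      by (rule inj) (simp add: blinfun.add_right s)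
    show "s (r *\<^sub>R x) = r *\<^sub>R s x" for r x
      by (rule inj) (simp add: blinfun.scaleR_right s)
    show "norm (s x) \<le> norm x * (1 / d)" for x
      using below[of "s x"] \<open>d > 0\<close> by (simp add: s field_simps)
  qed
  then obtain S where S: "\<And>y. blinfun_apply S y = s y"
    using bounded_linear_Blinfun_apply by metis
  have "clinear_op S"
    unfolding clinear_op_def
  proof (intro allI, rule inj)
    show "R (S (c *\<^sub>C x)) = R (c *\<^sub>C S x)" for c x
      using R by (simp add: clinear_op_def S s)
  qed
  then show thesis
    using that[of S] inj by (simp add: S s)
qed

text \<open>For complex-linear T, symmetry for \<open>inner\<close> amounts to self-adjointness for
  \<open>cinner\<close>, so the real form suffices.\<close>

definition positive_op :: "('a::complex_inner \<Rightarrow>\<^sub>L 'a) \<Rightarrow> bool"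
  where "positive_op T \<longleftrightarrow> clinear_op T \<and> (\<forall>x y. inner (T x) y = inner x (T y)) \<and>
    (\<forall>x. 0 \<le> inner (T x) x)"

lemma positive_opD:
  assumes "positive_op T"
  shows "clinear_op T" "inner (T x) y = inner x (T y)" "0 \<le> inner (T x) x"
  using assms by (auto simp: positive_op_def)

lemma positive_op_adj_compose:
  fixes T :: "'a::complex_hilbert \<Rightarrow>\<^sub>L 'a"
  assumes "clinear_op T"
  shows "positive_op (adj T o\<^sub>L T)"
proof -
  have "inner ((adj T o\<^sub>L T) x) y = inner (T x) (T y)" for x y
    using inner_adj[OF assms, of y "T x"] by (simp add: inner_commute)
  moreover have "inner x ((adj T o\<^sub>L T) y) = inner (T x) (T y)" for x y
    by (simp add: inner_adj[OF assms])
  ultimately show ?thesis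
    using assms clinear_op_adj[OF assms] by (simp add: positive_op_def clinear_op_def)
qed

text \<open>For a < 0 the operator T - a is coercive with constant - a; for a above the norm of T,
  the operator a - T is coercive with constant \<open>a - norm T\<close>. Both are therefore
  invertible.\<close>

lemma spectrum_positive_op:
  fixes T :: "'a::complex_hilbert \<Rightarrow>\<^sub>L 'a"
  assumes T: "positive_op T" and a: "complex_of_real a \<in> spectrum T"
  shows "a \<in> {0..norm T}"
proof -
  have "0 \<le> a"
  proof (rule ccontr)
    assume "\<not> 0 \<le> a"
    define R where "R = T - a *\<^sub>R id_blinfun"
    have R_apply: "R x = T x - complex_of_real a *\<^sub>C x" for x
      by (simp add: R_def blinfun.bilinear_simps scaleC_of_real)
    have "clinear_op R"
      using positive_opD(1)[OF T]
      by (simp add: clinear_op_def R_apply scaleC_diff_right scaleC_scaleC mult.commute)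
    moreover have "- a * (norm x)\<^sup>2 \<le> inner (R x) x" for x
      using positive_opD(3)[OF T, of x]
      by (simp add: R_apply scaleC_of_real inner_diff_left dot_square_norm)
    ultimately obtain S where "clinear_op S" "\<And>x. blinfun_apply S (R x) = x"
        "\<And>x. R (blinfun_apply S x) = x"
      using coercive_invertible[of R "- a"] \<open>\<not> 0 \<le> a\<close> by auto
    then show False
      using a by (auto simp: spectrum_def R_apply)
  qed
  moreover have "a \<le> norm T"
  proof (rule ccontr)
    assume "\<not> a \<le> norm T"
    define R where "R = a *\<^sub>R id_blinfun - T"
    have R_apply: "R x = complex_of_real a *\<^sub>C x - T x" for x
      by (simp add: R_def blinfun.bilinear_simps scaleC_of_real)
    have "clinear_op R"
      using positive_opD(1)[OF T]
      by (simp add: clinear_op_def R_apply scaleC_diff_right scaleC_scaleC mult.commute)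
    moreover have "(a - norm T) * (norm x)\<^sup>2 \<le> inner (R x) x" for x
    proof -
      have "inner (T x) x \<le> norm T * norm x * norm x"
        using norm_cauchy_schwarz[of "T x" x] norm_blinfun[of T x]
        by (meson mult_right_mono norm_ge_zero order_trans)
      then show ?thesis
        by (simp add: R_apply scaleC_of_real inner_diff_left dot_square_norm power2_eq_square
            algebra_simps)
    qed
    ultimately obtain S where S: "clinear_op S" "\<And>x. blinfun_apply S (R x) = x"
        "\<And>x. R (blinfun_apply S x) = x"
      using coercive_invertible[of R "a - norm T"] \<open>\<not> a \<le> norm T\<close> by auto
    \<comment> \<open>\<open>spectrum\<close> is phrased with T - a while R is a - T, so the inverse
      required is - S.\<close>
    have "clinear_op (- S)"
      using S(1) by (simp add: clinear_op_def blinfun.minus_left scaleC_minus_right)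
    moreover have "(- S) (T x - complex_of_real a *\<^sub>C x) = x" for x
    proof -
      have "(- S) (T x - complex_of_real a *\<^sub>C x) = S (R x)"
        by (simp add: R_apply blinfun.bilinear_simps)
      then show ?thesis by (simp add: S)
    qed
    moreover have "T ((- S) x) - complex_of_real a *\<^sub>C (- S) x = x" for x
    proof -
      have "T ((- S) x) - complex_of_real a *\<^sub>C (- S) x = R (S x)"
        by (simp add: R_apply blinfun.bilinear_simps scaleC_of_real)
      then show ?thesis by (simp add: S)
    qed
    ultimately show False
      using a unfolding spectrum_def by blast
  qed
  ultimately show ?thesis by simp
qed

section \<open>Continuous functional calculus\<close>

lemma norm_poly_op_diff_le:
  fixes T :: "'a::complex_inner \<Rightarrow>\<^sub>L 'a"
  assumes sym: "\<And>x y. inner (T x) y = inner x (T y)" and "e \<ge> 0"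
    and "\<And>a. complex_of_real a \<in> spectrum T \<Longrightarrow> dist (poly p a) (f a) \<le> e"
    and "\<And>a. complex_of_real a \<in> spectrum T \<Longrightarrow> dist (poly q a) (f a) \<le> e"
  shows "norm (poly_op p T - poly_op q T) \<le> 2 * e"
proof -
  have "\<bar>poly (p - q) a\<bar> \<le> 2 * e" if "complex_of_real a \<in> spectrum T" for a
    using assms(3,4)[OF that] by (auto simp: dist_real_def)
  then have "norm (poly_op (p - q) T) \<le> 2 * e"
    using \<open>e \<ge> 0\<close> by (intro norm_poly_op_le sym) auto
  then show ?thesis
    by (simp add: poly_op_diff)
qed

text \<open>Well-definedness of the \<open>THE\<close> in \<open>cfc\<close>: two approximating
  sequences are uniformly close on the spectrum, so their values at T differ by a null
  sequence.\<close>

lemma cfc_eqI: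
  fixes T :: "'a::complex_inner \<Rightarrow>\<^sub>L 'a"
  assumes sym: "\<And>x y. inner (T x) y = inner x (T y)"
    and p: "uniform_limit {a. complex_of_real a \<in> spectrum T} (\<lambda>n. poly (p n)) f sequentially"
    and S: "(\<lambda>n. poly_op (p n) T) \<longlonglongrightarrow> S"
  shows "cfc f T = S"
  unfolding cfc_def
proof (rule the_equality)
  show "\<exists>p. uniform_limit {x. complex_of_real x \<in> spectrum T} (\<lambda>n. poly (p n)) f sequentially \<and>
      (\<lambda>n. poly_op (p n) T) \<longlonglongrightarrow> S"
    using p S by blast
next
  fix S'
  assume "\<exists>p. uniform_limit {x. complex_of_real x \<in> spectrum T} (\<lambda>n. poly (p n)) f sequentially \<and>
      (\<lambda>n. poly_op (p n) T) \<longlonglongrightarrow> S'"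
  then obtain q where
    q: "uniform_limit {a. complex_of_real a \<in> spectrum T} (\<lambda>n. poly (q n)) f sequentially"
    and S': "(\<lambda>n. poly_op (q n) T) \<longlonglongrightarrow> S'"
    by blast
  have "(\<lambda>n. poly_op (p n) T - poly_op (q n) T) \<longlonglongrightarrow> 0"
  proof (rule tendstoI)
    fix e :: real assume "e > 0"
    then have "e / 3 > 0" by simp
    from uniform_limitD[OF p this] uniform_limitD[OF q this]
    show "\<forall>\<^sub>F n in sequentially. dist (poly_op (p n) T - poly_op (q n) T) 0 < e"
    proof eventually_elim
      case (elim n)
      then have "norm (poly_op (p n) T - poly_op (q n) T) \<le> 2 * (e / 3)"
        using \<open>e > 0\<close> by (intro norm_poly_op_diff_le[where f = f] sym) (auto intro: less_imp_le)
      then show ?case using \<open>e > 0\<close> by simp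
    qed
  qed
  then have "S - S' = 0"
    using LIMSEQ_unique tendsto_diff[OF S S'] by blast
  then show "S' = S" by simp
qed

lemma cfc_limit_spectrum:
  fixes T :: "'a::complex_hilbert \<Rightarrow>\<^sub>L 'a"
  assumes sym: "\<And>x y. inner (T x) y = inner x (T y)"
    and p: "uniform_limit {a. complex_of_real a \<in> spectrum T} (\<lambda>n. poly (p n)) f sequentially"
  shows "(\<lambda>n. poly_op (p n) T) \<longlonglongrightarrow> cfc f T"
proof -
  have "Cauchy (\<lambda>n. poly_op (p n) T)"
  proof (rule metric_CauchyI)
    fix e :: real assume "e > 0"
    then have "e / 3 > 0" by simp
    from uniform_limitD[OF p this] obtain N where
      N: "\<forall>n\<ge>N. \<forall>a\<in>{a. complex_of_real a \<in> spectrum T}. dist (poly (p n) a) (f a) < e / 3"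
      unfolding eventually_sequentially by blast
    show "\<exists>N. \<forall>m\<ge>N. \<forall>n\<ge>N. dist (poly_op (p m) T) (poly_op (p n) T) < e"
    proof (intro exI allI impI)
      fix m n assume "m \<ge> N" "n \<ge> N"
      then have "norm (poly_op (p m) T - poly_op (p n) T) \<le> 2 * (e / 3)"
        using \<open>e > 0\<close> N
        by (intro norm_poly_op_diff_le[where f = f] sym) (auto intro: less_imp_le)
      then show "dist (poly_op (p m) T) (poly_op (p n) T) < e"
        using \<open>e > 0\<close> by (simp add: dist_norm)
    qed
  qed
  then obtain S where S: "(\<lambda>n. poly_op (p n) T) \<longlonglongrightarrow> S"
    using Cauchy_convergent convergent_def by blast
  then show ?thesis
    using cfc_eqI[OF sym p S] by simp
qed

text \<open>The spectrum lies in [0, \<open>norm T\<close>]. Allowing a larger K lets one polynomial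
  sequence serve two operators at once.\<close>

lemma cfc_limit:
  fixes T :: "'a::complex_hilbert \<Rightarrow>\<^sub>L 'a"
  assumes "positive_op T" "norm T \<le> K"
    and "uniform_limit {0..K} (\<lambda>n. poly (p n)) f sequentially"
  shows "(\<lambda>n. poly_op (p n) T) \<longlonglongrightarrow> cfc f T"
proof (rule cfc_limit_spectrum)
  show "uniform_limit {a. complex_of_real a \<in> spectrum T} (\<lambda>n. poly (p n)) f sequentially"
    using assms(3) by (rule uniform_limit_on_subset)
      (use assms(2) spectrum_positive_op[OF assms(1)] in fastforce)
qed (rule positive_opD(2)[OF assms(1)])

lemma poly_uniform_limit:
  fixes f :: "real \<Rightarrow> real"
  assumes "continuous_on {a..b} f"
  obtains p where "uniform_limit {a..b} (\<lambda>n. poly (p n)) f sequentially"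
proof -
  have "\<exists>p. \<forall>x\<in>{a..b}. \<bar>f x - poly p x\<bar> < inverse (real (Suc n))" for n
  proof -
    obtain g where g: "real_polynomial_function g"
      "\<And>x. x \<in> {a..b} \<Longrightarrow> \<bar>f x - g x\<bar> < inverse (real (Suc n))"
      using Stone_Weierstrass_real_polynomial_function[OF _ assms, of "inverse (real (Suc n))"]
      by auto
    then obtain c m where "g = (\<lambda>x. \<Sum>i\<le>m. c i * x ^ i)"
      by (auto simp: real_polynomial_function_iff_sum)
    then have "g = poly (\<Sum>i\<le>m. monom (c i) i)"
      by (simp add: fun_eq_iff poly_sum poly_monom)
    then show ?thesis using g by blast
  qed
  then obtain p where p: "\<And>n x. x \<in> {a..b} \<Longrightarrow> \<bar>f x - poly (p n) x\<bar> < inverse (real (Suc n))"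
    by metis
  have "uniform_limit {a..b} (\<lambda>n. poly (p n)) f sequentially"
  proof (rule uniform_limitI)
    fix e :: real assume "e > 0"
    have "\<forall>\<^sub>F n in sequentially. inverse (real (Suc n)) < e"
      using LIMSEQ_inverse_real_of_nat \<open>e > 0\<close> by (rule order_tendstoD)
    then show "\<forall>\<^sub>F n in sequentially. \<forall>x\<in>{a..b}. dist (poly (p n) x) (f x) < e"
    proof eventually_elim
      case (elim n)
      then show ?case
        using p[of _ n] by (fastforce simp: dist_real_def abs_minus_commute)
    qed
  qed
  then show thesis by (rule that)
qed

lemma cfc_approx:
  fixes T :: "'a::complex_hilbert \<Rightarrow>\<^sub>L 'a"
  assumes T: "positive_op T" and f: "continuous_on {0..} f"
  obtains p where "uniform_limit {0..norm T} (\<lambda>n. poly (p n)) f sequentially"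
    "(\<lambda>n. poly_op (p n) T) \<longlonglongrightarrow> cfc f T"
proof -
  obtain p where "uniform_limit {0..norm T} (\<lambda>n. poly (p n)) f sequentially"
    using poly_uniform_limit continuous_on_subset[OF f] by (metis Icc_subset_Ici_iff order_refl)
  then show thesis
    using that cfc_limit[OF T order_refl] by blast
qed

lemma cfc_poly:
  fixes T :: "'a::complex_hilbert \<Rightarrow>\<^sub>L 'a"
  assumes "positive_op T"
  shows "cfc (poly p) T = poly_op p T"
  using positive_opD(2)[OF assms] by (rule cfc_eqI[where p = "\<lambda>_. p"]) (auto intro: uniform_limit_const)

lemma cfc_const: "positive_op T \<Longrightarrow> cfc (\<lambda>x. c) T = c *\<^sub>R id_blinfun"
  for T :: "'a::complex_hilbert \<Rightarrow>\<^sub>L 'a"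
  using cfc_poly[of T "[:c:]"] ext[of "poly [:c:]" "\<lambda>x. c"]
  by (simp add: poly_op_pCons poly_op_0)

lemma cfc_ident: "positive_op T \<Longrightarrow> cfc (\<lambda>x. x) T = T"
  for T :: "'a::complex_hilbert \<Rightarrow>\<^sub>L 'a"
proof -
  have "T o\<^sub>L id_blinfun = T"
    by (rule blinfun_eqI) simp
  moreover have "poly [:0, 1:] = (\<lambda>x::real. x)"
    by (rule ext) simp
  ultimately show "positive_op T \<Longrightarrow> cfc (\<lambda>x. x) T = T"
    using cfc_poly[of T "[:0, 1:]"] by (simp add: poly_op_pCons poly_op_0 del: poly_pCons)
qed

text \<open>\<open>cfc\<close> sees the function only on the spectrum, which is nonnegative
  here.\<close>

lemma cfc_cong:
  fixes T :: "'a::complex_hilbert \<Rightarrow>\<^sub>L 'a"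
  assumes "positive_op T" "\<And>x. x \<ge> 0 \<Longrightarrow> f x = g x"
  shows "cfc f T = cfc g T"
proof -
  have "uniform_limit {x. complex_of_real x \<in> spectrum T} P f F
      \<longleftrightarrow> uniform_limit {x. complex_of_real x \<in> spectrum T} P g F" for P :: "nat \<Rightarrow> real \<Rightarrow> real" and F
    using assms spectrum_positive_op[OF assms(1)] by (intro uniform_limit_cong') auto
  then show ?thesis
    by (simp add: cfc_def)
qed

lemma bounded_continuous_image_Icc:
  fixes f :: "real \<Rightarrow> real"
  assumes "continuous_on {0..} f"
  shows "bounded (f ` {0..K})"
  using assms continuous_on_subset[of "{0..}" f "{0..K}"]
  by (intro compact_imp_bounded compact_continuous_image) auto

section \<open>Algebra, order and composition in the functional calculus\<close>

lemma cfc_mult: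
  fixes T :: "'a::complex_hilbert \<Rightarrow>\<^sub>L 'a"
  assumes T: "positive_op T" and f: "continuous_on {0..} f" and g: "continuous_on {0..} g"
  shows "cfc (\<lambda>x. f x * g x) T = cfc f T o\<^sub>L cfc g T"
proof -
  obtain p where p: "uniform_limit {0..norm T} (\<lambda>n. poly (p n)) f sequentially"
    "(\<lambda>n. poly_op (p n) T) \<longlonglongrightarrow> cfc f T"
    using cfc_approx[OF T f] .
  obtain q where q: "uniform_limit {0..norm T} (\<lambda>n. poly (q n)) g sequentially"
    "(\<lambda>n. poly_op (q n) T) \<longlonglongrightarrow> cfc g T"
    using cfc_approx[OF T g] .
  have "uniform_limit {0..norm T} (\<lambda>n. poly (p n * q n)) (\<lambda>x. f x * g x) sequentially"
    using uniform_lim_mult[OF p(1) q(1)] bounded_continuous_image_Icc f g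
    by (simp add: uniform_limit_iff)
  then have "(\<lambda>n. poly_op (p n * q n) T) \<longlonglongrightarrow> cfc (\<lambda>x. f x * g x) T"
    by (rule cfc_limit[OF T order_refl])
  moreover have "(\<lambda>n. poly_op (p n * q n) T) \<longlonglongrightarrow> (cfc f T o\<^sub>L cfc g T)"
    unfolding poly_op_mult
    by (rule bounded_bilinear.tendsto[OF bounded_bilinear_blinfun_compose p(2) q(2)])
  ultimately show ?thesis
    by (rule LIMSEQ_unique)
qed

lemma cfc_add:
  fixes T :: "'a::complex_hilbert \<Rightarrow>\<^sub>L 'a"
  assumes T: "positive_op T" and f: "continuous_on {0..} f" and g: "continuous_on {0..} g"
  shows "cfc (\<lambda>x. f x + g x) T = cfc f T + cfc g T"
proof -
  obtain p where p: "uniform_limit {0..norm T} (\<lambda>n. poly (p n)) f sequentially"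
    "(\<lambda>n. poly_op (p n) T) \<longlonglongrightarrow> cfc f T"
    using cfc_approx[OF T f] .
  obtain q where q: "uniform_limit {0..norm T} (\<lambda>n. poly (q n)) g sequentially"
    "(\<lambda>n. poly_op (q n) T) \<longlonglongrightarrow> cfc g T"
    using cfc_approx[OF T g] .
  have "uniform_limit {0..norm T} (\<lambda>n. poly (p n + q n)) (\<lambda>x. f x + g x) sequentially"
    using uniform_limit_add[OF p(1) q(1)] by (simp add: uniform_limit_iff)
  then have "(\<lambda>n. poly_op (p n + q n) T) \<longlonglongrightarrow> cfc (\<lambda>x. f x + g x) T"
    by (rule cfc_limit[OF T order_refl])
  moreover have "(\<lambda>n. poly_op (p n + q n) T) \<longlonglongrightarrow> cfc f T + cfc g T"
    unfolding poly_op_add by (intro tendsto_add p q)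
  ultimately show ?thesis
    by (rule LIMSEQ_unique)
qed

lemma cfc_diff:
  fixes T :: "'a::complex_hilbert \<Rightarrow>\<^sub>L 'a"
  assumes T: "positive_op T" and f: "continuous_on {0..} f" and g: "continuous_on {0..} g"
  shows "cfc (\<lambda>x. f x - g x) T = cfc f T - cfc g T"
  using cfc_add[OF T continuous_on_diff[OF f g] g] by simp

lemma norm_cfc_le:
  fixes T :: "'a::complex_hilbert \<Rightarrow>\<^sub>L 'a"
  assumes T: "positive_op T" and f: "continuous_on {0..} f"
    and M: "M \<ge> 0" "\<And>x. x \<in> {0..norm T} \<Longrightarrow> \<bar>f x\<bar> \<le> M"
  shows "norm (cfc f T) \<le> M"
proof (rule field_le_epsilon)
  fix e :: real assume "e > 0"
  obtain p where p: "uniform_limit {0..norm T} (\<lambda>n. poly (p n)) f sequentially"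
    and lim: "(\<lambda>n. poly_op (p n) T) \<longlonglongrightarrow> cfc f T"
    using cfc_approx[OF T f] .
  have "\<forall>\<^sub>F n in sequentially. norm (poly_op (p n) T) \<le> M + e"
    using uniform_limitD[OF p \<open>e > 0\<close>]
  proof eventually_elim
    case (elim n)
    have "\<bar>poly (p n) a\<bar> \<le> M + e" if "complex_of_real a \<in> spectrum T" for a
      using spectrum_positive_op[OF T that] elim M(2) by (fastforce simp: dist_real_def)
    then show ?case
      using positive_opD(2)[OF T] M(1) \<open>e > 0\<close> by (intro norm_poly_op_le) auto
  qed
  then show "norm (cfc f T) \<le> M + e"
    by (intro tendsto_upperbound[OF tendsto_norm[OF lim]]) auto
qed

lemma cfc_symmetric:
  fixes T :: "'a::complex_hilbert \<Rightarrow>\<^sub>L 'a"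
  assumes T: "positive_op T" and f: "continuous_on {0..} f"
  shows "inner (cfc f T x) y = inner x (cfc f T y)"
proof -
  obtain p where lim: "(\<lambda>n. poly_op (p n) T) \<longlonglongrightarrow> cfc f T"
    using cfc_approx[OF T f] .
  have "(\<lambda>n. inner (poly_op (p n) T x) y) \<longlonglongrightarrow> inner (cfc f T x) y"
    by (intro tendsto_inner blinfun.tendsto lim tendsto_const)
  moreover have "(\<lambda>n. inner x (poly_op (p n) T y)) \<longlonglongrightarrow> inner x (cfc f T y)"
    by (intro tendsto_inner blinfun.tendsto lim tendsto_const)
  ultimately show ?thesis
    using poly_op_symmetric[OF positive_opD(2)[OF T]] LIMSEQ_unique by simp
qed

lemma clinear_op_cfc:
  fixes T :: "'a::complex_hilbert \<Rightarrow>\<^sub>L 'a"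
  assumes T: "positive_op T" and f: "continuous_on {0..} f"
  shows "clinear_op (cfc f T)"
  unfolding clinear_op_def
proof (intro allI)
  fix c x
  obtain p where lim: "(\<lambda>n. poly_op (p n) T) \<longlonglongrightarrow> cfc f T"
    using cfc_approx[OF T f] .
  have "(\<lambda>n. poly_op (p n) T (c *\<^sub>C x)) \<longlonglongrightarrow> cfc f T (c *\<^sub>C x)"
    by (intro blinfun.tendsto lim tendsto_const)
  moreover have "(\<lambda>n. c *\<^sub>C poly_op (p n) T x) \<longlonglongrightarrow> c *\<^sub>C cfc f T x"
    by (intro bounded_linear.tendsto[OF bounded_linear_scaleC] blinfun.tendsto lim tendsto_const)
  ultimately show "cfc f T (c *\<^sub>C x) = c *\<^sub>C cfc f T x"
    using clinear_op_poly_op[OF positive_opD(1)[OF T]] LIMSEQ_unique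
    by (simp add: clinear_op_def)
qed

text \<open>Writing f as the square of its root turns the quadratic form into a squared
  norm.\<close>

lemma cfc_nonneg:
  fixes T :: "'a::complex_hilbert \<Rightarrow>\<^sub>L 'a"
  assumes T: "positive_op T" and f: "continuous_on {0..} f" and nonneg: "\<And>x. x \<ge> 0 \<Longrightarrow> f x \<ge> 0"
  shows "0 \<le> inner (cfc f T x) x"
proof -
  have sqrt: "continuous_on {0..} (\<lambda>x. sqrt (f x))"
    by (intro continuous_on_real_sqrt f)
  have "cfc f T = cfc (\<lambda>x. sqrt (f x) * sqrt (f x)) T"
    using T by (rule cfc_cong) (simp add: nonneg)
  also have "\<dots> = cfc (\<lambda>x. sqrt (f x)) T o\<^sub>L cfc (\<lambda>x. sqrt (f x)) T"
    by (rule cfc_mult[OF T sqrt sqrt])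
  finally have "inner (cfc f T x) x = inner (cfc (\<lambda>x. sqrt (f x)) T x) (cfc (\<lambda>x. sqrt (f x)) T x)"
    by (simp add: cfc_symmetric[OF T sqrt])
  then show ?thesis
    by (simp only: inner_ge_zero)
qed

lemma positive_op_cfc:
  fixes T :: "'a::complex_hilbert \<Rightarrow>\<^sub>L 'a"
  assumes "positive_op T" "continuous_on {0..} f" "\<And>x. x \<ge> 0 \<Longrightarrow> f x \<ge> 0"
  shows "positive_op (cfc f T)"
  unfolding positive_op_def[of "cfc f T"]
  by (intro conjI allI clinear_op_cfc cfc_symmetric cfc_nonneg assms)

lemma cfc_mono:
  fixes T :: "'a::complex_hilbert \<Rightarrow>\<^sub>L 'a"
  assumes "positive_op T" "continuous_on {0..} f" "continuous_on {0..} g"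
    and "\<And>x. x \<ge> 0 \<Longrightarrow> f x \<le> g x"
  shows "inner (cfc f T x) x \<le> inner (cfc g T x) x"
  using cfc_nonneg[of T "\<lambda>x. g x - f x" x] assms
  by (simp add: cfc_diff continuous_on_diff blinfun.diff_left inner_diff_left)

text \<open>Polynomials intertwine; a single sequence approximating f on an interval that contains
  both spectra carries this to the limit.\<close>

lemma cfc_intertwine:
  fixes S T B :: "'a::complex_hilbert \<Rightarrow>\<^sub>L 'a"
  assumes S: "positive_op S" and T: "positive_op T" and f: "continuous_on {0..} f"
    and B: "\<And>x. B (S x) = T (B x)"
  shows "B (cfc f S x) = cfc f T (B x)"
proof -
  define K where "K = max (norm S) (norm T)"
  have K: "norm S \<le> K" "norm T \<le> K"
    by (simp_all add: K_def)
  obtain p where p: "uniform_limit {0..K} (\<lambda>n. poly (p n)) f sequentially"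
    using poly_uniform_limit continuous_on_subset[OF f] by (metis Icc_subset_Ici_iff order_refl)
  have "(\<lambda>n. B (poly_op (p n) S x)) \<longlonglongrightarrow> B (cfc f S x)"
    by (intro blinfun.tendsto cfc_limit[OF S K(1) p] tendsto_const)
  moreover have "(\<lambda>n. poly_op (p n) T (B x)) \<longlonglongrightarrow> cfc f T (B x)"
    by (intro blinfun.tendsto cfc_limit[OF T K(2) p] tendsto_const)
  ultimately show ?thesis
    using poly_op_intertwine[OF B] LIMSEQ_unique by simp
qed

text \<open>For polynomial g this is additivity and multiplicativity. In general both sides are
  limits of the same sequence \<open>poly_op (p n) (cfc f T)\<close>.\<close>

lemma cfc_compose:
  fixes T :: "'a::complex_hilbert \<Rightarrow>\<^sub>L 'a"
  assumes T: "positive_op T" and f: "continuous_on {0..} f" and g: "continuous_on {0..} g"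
    and nonneg: "\<And>x. x \<ge> 0 \<Longrightarrow> f x \<ge> 0"
  shows "cfc g (cfc f T) = cfc (\<lambda>x. g (f x)) T"
proof -
  have gf: "continuous_on {0..} (\<lambda>x. g (f x))"
    using nonneg by (intro continuous_on_compose2[OF g f]) auto
  have poly_f: "continuous_on {0..} (\<lambda>x. poly p (f x))" for p
    by (intro continuous_on_poly f)
  have pos: "positive_op (cfc f T)"
    using T f nonneg by (rule positive_op_cfc)
  have poly: "poly_op p (cfc f T) = cfc (\<lambda>x. poly p (f x)) T" for p
  proof (induction p)
    case 0
    show ?case using cfc_const[OF T, of 0] by (simp add: poly_op_0)
  next
    case (pCons a p)
    have "cfc (\<lambda>x. poly (pCons a p) (f x)) T = cfc (\<lambda>x. a) T + cfc (\<lambda>x. f x * poly p (f x)) T"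
      using cfc_add[OF T continuous_on_const continuous_on_mult[OF f poly_f]] by simp
    then show ?case
      by (simp add: poly_op_pCons pCons cfc_const[OF T] cfc_mult[OF T f poly_f])
  qed
  obtain M where M: "\<And>x. x \<in> {0..norm T} \<Longrightarrow> \<bar>f x\<bar> \<le> M"
    using bounded_continuous_image_Icc[OF f, of "norm T"] by (force simp: bounded_iff)
  \<comment> \<open>The interval [0, K] contains the spectrum of f(T), for the first limit, and the
    values of f on [0, \<open>norm T\<close>], for the second.\<close>
  define K where "K = max (norm (cfc f T)) M"
  obtain p where p: "uniform_limit {0..K} (\<lambda>n. poly (p n)) g sequentially"
    using poly_uniform_limit continuous_on_subset[OF g] by (metis Icc_subset_Ici_iff order_refl)
  have "(\<lambda>n. poly_op (p n) (cfc f T)) \<longlonglongrightarrow> cfc g (cfc f T)"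
    using pos _ p by (rule cfc_limit) (simp add: K_def)
  moreover have "(\<lambda>n. poly_op (p n) (cfc f T)) \<longlonglongrightarrow> cfc (\<lambda>x. g (f x)) T"
  proof (rule tendstoI)
    fix e :: real assume "e > 0"
    then have "e / 2 > 0" by simp
    from uniform_limitD[OF p this]
    show "\<forall>\<^sub>F n in sequentially. dist (poly_op (p n) (cfc f T)) (cfc (\<lambda>x. g (f x)) T) < e"
    proof eventually_elim
      case (elim n)
      have "norm (cfc (\<lambda>x. poly (p n) (f x) - g (f x)) T) \<le> e / 2"
      proof (rule norm_cfc_le[OF T continuous_on_diff[OF poly_f gf]])
        fix x assume x: "x \<in> {0..norm T}"
        then have "f x \<in> {0..K}"
          using M[OF x] nonneg[of x] by (auto simp: K_def)
        then show "\<bar>poly (p n) (f x) - g (f x)\<bar> \<le> e / 2"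
          using elim by (force simp: dist_real_def)
      qed (use \<open>e > 0\<close> in simp)
      then show ?case
        using \<open>e > 0\<close> by (simp add: dist_norm poly cfc_diff[OF T poly_f gf])
    qed
  qed
  ultimately show ?thesis
    by (rule LIMSEQ_unique)
qed

section \<open>Powers of the absolute value\<close>

text \<open>Being 1 at exponent 0 even for x = 0, it is continuous on [0, \<infinity>) for every s
  \<ge> 0 and merges the two cases of \<open>op_powr\<close>.\<close>

definition real_pow :: "real \<Rightarrow> real \<Rightarrow> real"
  where "real_pow s x = (if s = 0 then 1 else x powr s)"

lemma continuous_on_real_pow: "0 \<le> s \<Longrightarrow> continuous_on {0..} (real_pow s)"
  unfolding real_pow_def
  by (cases "s = 0") (auto intro!: continuous_on_powr')

lemma real_pow_nonneg: "0 \<le> real_pow s x"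
  by (simp add: real_pow_def)

lemma real_pow_pos: "0 < x \<Longrightarrow> real_pow s x = x powr s"
  by (simp add: real_pow_def)

lemma real_pow_half_mult: "0 \<le> x \<Longrightarrow> real_pow (s / 2) x * real_pow (s / 2) x = real_pow s x"
  by (simp add: real_pow_def flip: powr_add)

lemma op_powr_eq_cfc:
  fixes T :: "'a::complex_hilbert \<Rightarrow>\<^sub>L 'a"
  assumes "positive_op T"
  shows "op_powr T s = cfc (real_pow s) T"
  using cfc_const[OF assms, of 1] by (simp add: op_powr_def real_pow_def[abs_def])

lemma op_abs_eq_cfc:
  fixes T :: "'a::complex_hilbert \<Rightarrow>\<^sub>L 'a"
  assumes "clinear_op T"
  shows "op_abs T = cfc (real_pow (1 / 2)) (adj T o\<^sub>L T)"
  by (simp add: op_abs_def op_powr_eq_cfc positive_op_adj_compose assms)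

lemma positive_op_abs:
  fixes T :: "'a::complex_hilbert \<Rightarrow>\<^sub>L 'a"
  assumes "clinear_op T"
  shows "positive_op (op_abs T)"
  unfolding op_abs_eq_cfc[OF assms]
  by (intro positive_op_cfc positive_op_adj_compose assms continuous_on_real_pow real_pow_nonneg) simp

text \<open>The even exponent absorbs the square root in |T|, so everything can be computed in the
  calculus of \<open>adj T o\<^sub>L T\<close>.\<close>

lemma op_powr_op_abs:
  fixes T :: "'a::complex_hilbert \<Rightarrow>\<^sub>L 'a"
  assumes T: "clinear_op T" and "0 \<le> s"
  shows "op_powr (op_abs T) (2 * s) = cfc (real_pow s) (adj T o\<^sub>L T)"
proof -
  have "op_powr (op_abs T) (2 * s) = cfc (real_pow (2 * s)) (op_abs T)"
    by (rule op_powr_eq_cfc[OF positive_op_abs[OF T]])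
  also have "\<dots> = cfc (\<lambda>x. real_pow (2 * s) (real_pow (1 / 2) x)) (adj T o\<^sub>L T)"
    unfolding op_abs_eq_cfc[OF T] using \<open>0 \<le> s\<close>
    by (intro cfc_compose positive_op_adj_compose T continuous_on_real_pow real_pow_nonneg) auto
  also have "\<dots> = cfc (real_pow s) (adj T o\<^sub>L T)"
    by (intro cfc_cong positive_op_adj_compose T) (simp add: real_pow_def powr_powr)
  finally show ?thesis .
qed

lemma op_powr_one:
  fixes T :: "'a::complex_hilbert \<Rightarrow>\<^sub>L 'a"
  assumes "positive_op T"
  shows "op_powr T 1 = T"
proof -
  have "op_powr T 1 = cfc (\<lambda>x. x) T"
    unfolding op_powr_eq_cfc[OF assms] by (rule cfc_cong[OF assms]) (simp add: real_pow_def)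
  then show ?thesis
    by (simp add: cfc_ident assms)
qed

section \<open>Mixed Schwarz inequality\<close>

text \<open>
  The norm of the row operator \<open>(P, Q)\<close> is \<open>sqrt (\<parallel>P\<^sup>2 + Q\<^sup>2\<parallel>)\<close>; polarization then isolates the
  mixed term.
\<close>

lemma inner_le_norm_sum_squares:
  fixes P Q :: "'a::real_inner \<Rightarrow>\<^sub>L 'a"
  assumes P: "\<And>x y. inner (P x) y = inner x (P y)" and Q: "\<And>x y. inner (Q x) y = inner x (Q y)"
  shows "inner (P a) (Q b) \<le> norm ((P o\<^sub>L P) + (Q o\<^sub>L Q)) / 2 * norm a * norm b"
proof -
  define K where "K = norm ((P o\<^sub>L P) + (Q o\<^sub>L Q))"
  have row: "(norm (P u + Q v))\<^sup>2 \<le> K * ((norm u)\<^sup>2 + (norm v)\<^sup>2)" for u v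
  proof (cases "P u + Q v = 0")
    case True
    then show ?thesis by (simp add: K_def)
  next
    case False
    define y where "y = P u + Q v"
    have "(norm (P y))\<^sup>2 + (norm (Q y))\<^sup>2 = inner (((P o\<^sub>L P) + (Q o\<^sub>L Q)) y) y"
      by (simp add: blinfun.bilinear_simps inner_add_left P Q flip: dot_square_norm)
    also have "\<dots> \<le> norm (((P o\<^sub>L P) + (Q o\<^sub>L Q)) y) * norm y"
      by (rule norm_cauchy_schwarz)
    also have "\<dots> \<le> K * norm y * norm y"
      unfolding K_def by (intro mult_right_mono norm_blinfun) auto
    finally have col: "(norm (P y))\<^sup>2 + (norm (Q y))\<^sup>2 \<le> K * (norm y)\<^sup>2"
      by (simp add: power2_eq_square)
    \<comment> \<open>Duality: by symmetry of P and Q, the column estimate \<open>col\<close> yields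
      the row estimate through Cauchy-Schwarz.\<close>
    have "(norm y)\<^sup>2 = inner u (P y) + inner v (Q y)"
      by (simp add: y_def inner_add_left P Q flip: dot_square_norm)
    also have "\<dots> \<le> norm u * norm (P y) + norm v * norm (Q y)"
      by (intro add_mono norm_cauchy_schwarz)
    finally have "((norm y)\<^sup>2)\<^sup>2 \<le> (norm u * norm (P y) + norm v * norm (Q y))\<^sup>2"
      by (intro power_mono) auto
    also have "\<dots> \<le> ((norm u)\<^sup>2 + (norm v)\<^sup>2) * ((norm (P y))\<^sup>2 + (norm (Q y))\<^sup>2)"
      using zero_le_power2[of "norm u * norm (Q y) - norm v * norm (P y)"]
      by (simp add: power2_eq_square algebra_simps)
    also have "\<dots> \<le> ((norm u)\<^sup>2 + (norm v)\<^sup>2) * (K * (norm y)\<^sup>2)"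
      by (intro mult_left_mono col) simp
    finally have "(norm y)\<^sup>2 * (norm y)\<^sup>2 \<le> (K * ((norm u)\<^sup>2 + (norm v)\<^sup>2)) * (norm y)\<^sup>2"
      by (simp add: power2_eq_square mult_ac)
    moreover have "(norm y)\<^sup>2 > 0"
      using False by (simp add: y_def)
    ultimately show ?thesis
      unfolding y_def by (simp only: mult_le_cancel_right_pos)
  qed
  have sum: "4 * inner (P u) (Q v) \<le> K * ((norm u)\<^sup>2 + (norm v)\<^sup>2)" for u v
  proof -
    have "4 * inner (P u) (Q v) = (norm (P u + Q v))\<^sup>2 - (norm (P u - Q v))\<^sup>2"
      by (simp add: inner_diff_left inner_diff_right inner_add_left inner_add_right inner_commute
          flip: dot_square_norm)
    then show ?thesis
      using row[of u v] zero_le_power2[of "norm (P u - Q v)"] by linarith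
  qed
  show ?thesis
  proof (cases "a = 0 \<or> b = 0")
    case False
    \<comment> \<open>Normalizing both vectors turns the sum of squares into a product of
      norms.\<close>
    then have "norm ((1 / norm a) *\<^sub>R a) = 1" "norm ((1 / norm b) *\<^sub>R b) = 1"
      by auto
    then have "4 * (inner (P a) (Q b) / (norm a * norm b)) \<le> K * 2"
      using sum[of "(1 / norm a) *\<^sub>R a" "(1 / norm b) *\<^sub>R b"]
      by (simp add: blinfun.scaleR_right mult_ac)
    then show ?thesis
      using False by (simp add: K_def field_simps)
  qed auto
qed

section \<open>Approximate polar factorization\<close>

text \<open>The shift e makes s^(-r/2) continuous at 0, and it only decreases a negative power. This
  scalar estimate will bound the norms of the approximating vectors.\<close>

lemma mult_powr_shift_le:
  fixes s e r :: real
  assumes "0 \<le> s" "0 < e" "0 \<le> r"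
  shows "s * ((s + e) powr (- (r / 2)))\<^sup>2 \<le> real_pow (1 - r) s"
proof (cases "s = 0")
  case False
  then have "s > 0" using assms by simp
  have "s * ((s + e) powr (- (r / 2)))\<^sup>2 = s * (s + e) powr (- r)"
    by (simp add: power2_eq_square flip: powr_add)
  also have "\<dots> \<le> s * s powr (- r)"
    using \<open>s > 0\<close> assms by (intro mult_left_mono powr_mono2') auto
  also have "\<dots> = real_pow (1 - r) s"
    using \<open>s > 0\<close> by (simp add: real_pow_pos powr_diff powr_minus divide_inverse)
  finally show ?thesis .
qed (simp add: real_pow_nonneg)

text \<open>With u = s / (s + e) the product of powers is h = u^(r/2), which lies between u and 1,
  and s (1 - u) = e u. The factor s compensates for h being far from 1 near s = 0.\<close>

lemma mult_square_deviation_le: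
  fixes s e r :: real
  assumes "0 \<le> s" "0 < e" "0 \<le> r" "r \<le> 1"
  shows "s * (real_pow (r / 2) s * (s + e) powr (- (r / 2)) - 1)\<^sup>2 \<le> e"
proof (cases "s = 0")
  case False
  then have "s > 0" using assms by simp
  define u where "u = s / (s + e)"
  have u: "0 < u" "u \<le> 1"
    using \<open>s > 0\<close> assms by (auto simp: u_def)
  define h where "h = u powr (r / 2)"
  have h: "real_pow (r / 2) s * (s + e) powr (- (r / 2)) = h"
    using \<open>s > 0\<close> assms
    by (simp add: h_def u_def real_pow_pos powr_divide powr_minus_divide)
  have "u powr 1 \<le> h"
    unfolding h_def using u assms by (intro powr_mono') auto
  moreover have "h \<le> 1"
    unfolding h_def using u assms powr_mono2[of "r / 2" u 1] by simp
  ultimately have "(1 - h)\<^sup>2 \<le> (1 - u)\<^sup>2"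
    using u by (intro power_mono) auto
  also have "\<dots> \<le> 1 - u"
    using u by (simp add: power2_eq_square mult_left_le)
  finally have "s * (h - 1)\<^sup>2 \<le> s * (1 - u)"
    using \<open>s > 0\<close> by (simp add: power2_commute)
  also have "\<dots> = e * u"
    using \<open>s > 0\<close> assms by (simp add: u_def field_simps)
  also have "\<dots> \<le> e"
    using u assms by simp
  finally show ?thesis
    by (simp add: h)
qed (use assms in simp)

text \<open>With S = \<open>adj B o\<^sub>L B\<close>, the squared norm is the quadratic form of
  f(S) S f(S). It turns operator estimates into scalar bounds on s f(s)^2.\<close>

lemma norm_apply_cfc:
  fixes B :: "'a::complex_hilbert \<Rightarrow>\<^sub>L 'a"
  assumes B: "clinear_op B" and f: "continuous_on {0..} f"
  shows "(norm (B (cfc f (adj B o\<^sub>L B) x)))\<^sup>2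
    = inner (cfc (\<lambda>s. s * (f s)\<^sup>2) (adj B o\<^sub>L B) x) x"
proof -
  define S where "S = adj B o\<^sub>L B"
  have S: "positive_op S"
    unfolding S_def by (rule positive_op_adj_compose[OF B])
  have xf: "continuous_on {0..} (\<lambda>s. s * f s)"
    by (intro continuous_intros f)
  have "(norm (B (cfc f S x)))\<^sup>2 = inner (cfc f S x) (S (cfc f S x))"
    by (simp add: S_def inner_adj[OF B] flip: dot_square_norm)
  also have "\<dots> = inner x (cfc f S (S (cfc f S x)))"
    by (rule cfc_symmetric[OF S f])
  also have "cfc f S (S (cfc f S x)) = cfc (\<lambda>s. f s * (s * f s)) S x"
    using cfc_mult[OF S f xf] cfc_mult[OF S continuous_on_id f] by (simp add: cfc_ident[OF S])
  finally show ?thesis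
    by (simp add: S_def inner_commute power2_eq_square mult_ac)
qed

text \<open>
  This replaces the polar decomposition: formally \<open>B = |B\<^sup>*|\<^bsup>r\<^esup> V |B|\<^bsup>1-r\<^esup>\<close> with a
  partial isometry \<open>V\<close>, and \<open>b n\<close> approximates \<open>V |B|\<^bsup>1-r\<^esup> x\<close>.
\<close>

lemma approximate_factorization:
  fixes B :: "'a::complex_hilbert \<Rightarrow>\<^sub>L 'a"
  assumes B: "clinear_op B" and r: "0 \<le> r" "r \<le> 1"
  obtains b where "(\<lambda>n::nat. cfc (real_pow (r / 2)) (B o\<^sub>L adj B) (b n)) \<longlonglongrightarrow> B x"
    "\<And>n. (norm (b n))\<^sup>2 \<le> inner (cfc (real_pow (1 - r)) (adj B o\<^sub>L B) x) x"
proof -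
  define S where "S = adj B o\<^sub>L B"
  define T where "T = B o\<^sub>L adj B"
  have S: "positive_op S" and T: "positive_op T"
    using positive_op_adj_compose[OF B] positive_op_adj_compose[OF clinear_op_adj[OF B]]
    by (simp_all add: S_def T_def adj_adj[OF B])
  have BS: "B (S x) = T (B x)" for x
    by (simp add: S_def T_def)
  define e where "e n = inverse (real (Suc n))" for n
  have e: "e n > 0" for n
    by (simp add: e_def)
  \<comment> \<open>A regularization of s^(-r/2), so that B g(S) formally tends to B |B|^(-r) = V
    |B|^(1-r).\<close>
  define g where "g n s = (s + e n) powr (- (r / 2))" for n s
  have g: "continuous_on {0..} (g n)" for n
    unfolding g_def using e[of n]
    by (intro continuous_on_powr continuous_intros) (auto simp: add_nonneg_eq_0_iff)
  define q where "q = real_pow (r / 2)"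
  have q: "continuous_on {0..} q"
    unfolding q_def by (rule continuous_on_real_pow) (use r in simp)
  have qg: "continuous_on {0..} (\<lambda>s. q s * g n s)" for n
    by (intro continuous_intros q g)
  define b where "b n = B (cfc (g n) S x)" for n
  have "(norm (b n))\<^sup>2 \<le> inner (cfc (real_pow (1 - r)) S x) x" for n
  proof -
    have "(norm (b n))\<^sup>2 = inner (cfc (\<lambda>s. s * (g n s)\<^sup>2) S x) x"
      unfolding b_def S_def by (rule norm_apply_cfc[OF B g])
    also have "\<dots> \<le> inner (cfc (real_pow (1 - r)) S x) x"
    proof (rule cfc_mono[OF S])
      show "continuous_on {0..} (\<lambda>s. s * (g n s)\<^sup>2)"
        by (intro continuous_intros g)
      show "s * (g n s)\<^sup>2 \<le> real_pow (1 - r) s" if "0 \<le> s" for s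
        unfolding g_def using that e r(1) by (rule mult_powr_shift_le)
    qed (use r in \<open>simp add: continuous_on_real_pow\<close>)
    finally show ?thesis .
  qed
  moreover have "(\<lambda>n. cfc q T (b n)) \<longlonglongrightarrow> B x"
  proof (rule LIM_zero_cancel, rule Lim_null_comparison)
    have "norm (cfc q T (b n) - B x) \<le> sqrt (e n) * norm x" for n
    proof -
      have "cfc q T (b n) = B (cfc q S (cfc (g n) S x))"
        unfolding b_def by (rule cfc_intertwine[OF S T q BS, symmetric])
      \<comment> \<open>Intertwining has moved q to the right of B, so the error is B applied to a
        function of S and \<open>norm_apply_cfc\<close> reduces it to a scalar estimate.\<close>
      then have "cfc q T (b n) - B x = B (cfc (\<lambda>s. q s * g n s - 1) S x)"
        by (simp add: cfc_diff[OF S qg] cfc_mult[OF S q g] cfc_const[OF S] blinfun.bilinear_simps)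
      then have "(norm (cfc q T (b n) - B x))\<^sup>2
          = inner (cfc (\<lambda>s. s * (q s * g n s - 1)\<^sup>2) S x) x"
        unfolding S_def by (simp add: norm_apply_cfc[OF B] continuous_intros qg)
      also have "\<dots> \<le> inner (cfc (\<lambda>s. e n) S x) x"
      proof (rule cfc_mono[OF S])
        show "continuous_on {0..} (\<lambda>s. s * (q s * g n s - 1)\<^sup>2)"
          by (intro continuous_intros q g)
        show "s * (q s * g n s - 1)\<^sup>2 \<le> e n" if "0 \<le> s" for s
          unfolding g_def q_def using that e r by (rule mult_square_deviation_le)
      qed (rule continuous_on_const)
      also have "\<dots> = (sqrt (e n) * norm x)\<^sup>2"
        using e[of n] by (simp add: cfc_const[OF S] blinfun.scaleR_left power_mult_distrib dot_square_norm)
      finally show ?thesis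
        by (rule power2_le_imp_le) (use e[of n] in simp)
    qed
    then show "\<forall>\<^sub>F n in sequentially. norm (cfc q T (b n) - B x) \<le> sqrt (e n) * norm x"
      by simp
    have "(\<lambda>n. sqrt (e n) * norm x) \<longlonglongrightarrow> sqrt 0 * norm x"
      unfolding e_def by (intro tendsto_intros LIMSEQ_inverse_real_of_nat)
    then show "(\<lambda>n. sqrt (e n) * norm x) \<longlonglongrightarrow> 0"
      by simp
  qed
  ultimately show thesis
    using that by (simp add: S_def T_def q_def)
qed

text \<open>Both arguments are approximately factored through Q and P, the mixed term is bounded by
  half the norm of P^2 + Q^2, and the product of norms by half the sum of their squares. The vectors
  x and y stay independent so that a phase can be inserted later.\<close>

lemma inner_apply_adj_le:
  fixes A B :: "'a::complex_hilbert \<Rightarrow>\<^sub>L 'a"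
  assumes A: "clinear_op A" and B: "clinear_op B" and t: "0 \<le> t" "t \<le> 1"
  shows "inner (B x) (adj A y) \<le> 1/4 *
      norm (cfc (real_pow t) (adj A o\<^sub>L A) + cfc (real_pow (1 - t)) (B o\<^sub>L adj B)) *
      (inner (cfc (real_pow t) (adj B o\<^sub>L B) x) x + inner (cfc (real_pow (1 - t)) (A o\<^sub>L adj A) y) y)"
proof -
  define X where "X = adj A o\<^sub>L A"
  define Y where "Y = B o\<^sub>L adj B"
  have X: "positive_op X" and Y: "positive_op Y"
    using positive_op_adj_compose[OF A] positive_op_adj_compose[OF clinear_op_adj[OF B]]
    by (simp_all add: X_def Y_def adj_adj[OF B])
  define P where "P = cfc (real_pow (t / 2)) X"
  define Q where "Q = cfc (real_pow ((1 - t) / 2)) Y"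
  define K where "K = norm (cfc (real_pow t) X + cfc (real_pow (1 - t)) Y)"
  define \<beta> where "\<beta> = inner (cfc (real_pow t) (adj B o\<^sub>L B) x) x"
  define \<alpha> where "\<alpha> = inner (cfc (real_pow (1 - t)) (A o\<^sub>L adj A) y) y"
  have cont: "continuous_on {0..} (real_pow (t / 2))"
      "continuous_on {0..} (real_pow ((1 - t) / 2))"
    using t by (auto intro!: continuous_on_real_pow)
  have square: "P o\<^sub>L P = cfc (real_pow t) X" "Q o\<^sub>L Q = cfc (real_pow (1 - t)) Y"
    unfolding P_def Q_def
    by (simp_all only: X Y cont flip: cfc_mult)
      (auto intro!: cfc_cong X Y real_pow_half_mult)
  \<comment> \<open>The exponent r is 1 - t for B and t for \<open>adj A\<close>: this leaves P and
    Q on the inner side and the powers t and 1 - t in \<beta> and \<alpha>.\<close>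
  obtain b where b: "(\<lambda>n. Q (b n)) \<longlonglongrightarrow> B x" "\<And>n. (norm (b n))\<^sup>2 \<le> \<beta>"
    using approximate_factorization[OF B, of "1 - t" x] t
    by (auto simp: Q_def Y_def \<beta>_def)
  obtain a where a: "(\<lambda>n. P (a n)) \<longlonglongrightarrow> adj A y" "\<And>n. (norm (a n))\<^sup>2 \<le> \<alpha>"
    using approximate_factorization[OF clinear_op_adj[OF A], of t y] t
    by (auto simp: P_def X_def \<alpha>_def adj_adj[OF A])
  have "inner (Q (b n)) (P (a n)) \<le> 1/4 * K * (\<beta> + \<alpha>)" for n
  proof -
    have "inner (Q (b n)) (P (a n)) \<le> norm ((P o\<^sub>L P) + (Q o\<^sub>L Q)) / 2 * norm (a n) * norm (b n)"
      using inner_le_norm_sum_squares[of P Q "a n" "b n"]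
        cfc_symmetric[OF X cont(1)] cfc_symmetric[OF Y cont(2)]
      by (simp add: P_def Q_def inner_commute)
    also have "\<dots> = K / 2 * (norm (a n) * norm (b n))"
      by (simp add: K_def square)
    also have "\<dots> \<le> K / 2 * (((norm (a n))\<^sup>2 + (norm (b n))\<^sup>2) / 2)"
      using sum_squares_bound[of "norm (a n)" "norm (b n)"]
      by (intro mult_left_mono) (auto simp: K_def)
    also have "\<dots> \<le> K / 2 * ((\<beta> + \<alpha>) / 2)"
      using a(2)[of n] b(2)[of n] by (intro mult_left_mono) (auto simp: K_def)
    finally show ?thesis by simp
  qed
  moreover have "(\<lambda>n. inner (Q (b n)) (P (a n))) \<longlonglongrightarrow> inner (B x) (adj A y)"
    by (intro tendsto_inner a b)
  ultimately have "inner (B x) (adj A y) \<le> 1/4 * K * (\<beta> + \<alpha>)"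
    by (intro tendsto_upperbound[of _ _ sequentially]) auto
  then show ?thesis
    by (simp add: K_def X_def Y_def \<alpha>_def \<beta>_def)
qed

section \<open>Passage to the numerical radius\<close>

lemma cmod_cinner_rotate:
  fixes x y :: "'a::complex_inner"
  obtains c where "cmod c = 1" "cmod (cinner x y) = inner (c *\<^sub>C x) y"
proof
  define w where "w = cinner x y"
  define c where "c = (if w = 0 then 1 else cnj w / of_real (cmod w))"
  show "cmod c = 1"
    by (simp add: c_def norm_divide)
  have "c * w = of_real (cmod w)"
    by (auto simp: c_def complex_norm_square[symmetric] mult.commute[of "cnj w"] power2_eq_square
        simp del: of_real_power)
  then show "cmod (cinner x y) = inner (c *\<^sub>C x) y"
    by (metis Re_cinner Re_complex_of_real cinner_scaleC_left w_def)
qed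

text \<open>The phase that makes the form real and nonnegative moves into the argument of T by
  complex linearity, so bounds on real parts suffice. \<open>0 \<le> R\<close> covers the inserted
  0.\<close>

lemma numerical_radius_le:
  fixes T :: "'a::complex_inner \<Rightarrow>\<^sub>L 'a"
  assumes T: "clinear_op T" and "0 \<le> R"
    and le: "\<And>c x. cmod c = 1 \<Longrightarrow> norm x = 1 \<Longrightarrow> inner (T (c *\<^sub>C x)) x \<le> R"
  shows "numerical_radius T \<le> R"
  unfolding numerical_radius_def
proof (rule cSup_least)
  fix r assume "r \<in> insert 0 {cmod (cinner (T x) x) | x. norm x = 1}"
  moreover have "cmod (cinner (T x) x) \<le> R" if "norm x = 1" for x
    using le[OF _ that] T cmod_cinner_rotate[of "T x" x] by (metis clinear_op_def)
  ultimately show "r \<le> R"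
    using \<open>0 \<le> R\<close> by auto
qed simp

lemma inner_clinear_scaleC:
  assumes "clinear_op T" "cmod c = 1"
  shows "inner (T (c *\<^sub>C x)) (c *\<^sub>C x) = inner (T x) x"
proof -
  have "inner (T (c *\<^sub>C x)) (c *\<^sub>C x) = inner (T x) ((cnj c * c) *\<^sub>C x)"
    using assms(1) by (simp add: clinear_op_def inner_scaleC_left scaleC_scaleC)
  also have "cnj c * c = complex_of_real 1"
    using assms(2) complex_norm_square[of c] by (simp add: mult.commute)
  finally show ?thesis
    by (simp only: scaleC_of_real scaleR_one)
qed

text \<open>The mixed bound is applied to the pair c x, x. The phase drops out of the form of F, so
  the two forms add up to that of F + G at a unit vector.\<close>

lemma numerical_radius_compose_le:
  fixes A B :: "'a::complex_hilbert \<Rightarrow>\<^sub>L 'a"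
  assumes A: "clinear_op A" and B: "clinear_op B" and t: "0 \<le> t" "t \<le> 1"
  shows "numerical_radius (A o\<^sub>L B) \<le>
    1/4 * norm (op_powr (op_abs A) (2 * t) + op_powr (op_abs (adj B)) (2 * (1 - t)))
      * norm (op_powr (op_abs B) (2 * t) + op_powr (op_abs (adj A)) (2 * (1 - t)))"
proof -
  define F where "F = cfc (real_pow t) (adj B o\<^sub>L B)"
  define G where "G = cfc (real_pow (1 - t)) (A o\<^sub>L adj A)"
  define K where "K = norm (cfc (real_pow t) (adj A o\<^sub>L A) + cfc (real_pow (1 - t)) (B o\<^sub>L adj B))"
  have F: "clinear_op F"
    unfolding F_def using t by (intro clinear_op_cfc positive_op_adj_compose B continuous_on_real_pow)
  have "numerical_radius (A o\<^sub>L B) \<le> 1/4 * K * norm (F + G)"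
  proof (rule numerical_radius_le)
    show "clinear_op (A o\<^sub>L B)"
      using A B by (simp add: clinear_op_def)
    show "0 \<le> 1/4 * K * norm (F + G)"
      by (simp add: K_def)
    fix c and x :: 'a assume c: "cmod c = 1" and x: "norm x = 1"
    have "inner ((A o\<^sub>L B) (c *\<^sub>C x)) x = inner (B (c *\<^sub>C x)) (adj A x)"
      by (simp add: inner_adj[OF A])
    also have "\<dots> \<le> 1/4 * K * (inner (F (c *\<^sub>C x)) (c *\<^sub>C x) + inner (G x) x)"
      unfolding F_def G_def K_def by (rule inner_apply_adj_le[OF A B t])
    also have "inner (F (c *\<^sub>C x)) (c *\<^sub>C x) + inner (G x) x = inner ((F + G) x) x"
      by (simp add: inner_clinear_scaleC[OF F c] blinfun.add_left inner_add_left)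
    also have "1/4 * K * inner ((F + G) x) x \<le> 1/4 * K * norm (F + G)"
      using norm_cauchy_schwarz[of "(F + G) x" x] norm_blinfun[of "F + G" x]
      by (intro mult_left_mono) (auto simp: K_def x)
    finally show "inner ((A o\<^sub>L B) (c *\<^sub>C x)) x \<le> 1/4 * K * norm (F + G)" .
  qed
  then show ?thesis
    using t by (simp only: op_powr_op_abs A B clinear_op_adj adj_adj F_def G_def K_def diff_ge_0_iff_ge)
qed

theorem corollary2p10:
  fixes A B :: "'a::complex_hilbert \<Rightarrow>\<^sub>L 'a"
  assumes "clinear_op A" and "clinear_op B"
  shows "(\<forall>t\<in>{0..1::real}. numerical_radius (A o\<^sub>L B) \<le>
            1/4 * norm (op_powr (op_abs A) (2 * t) + op_powr (op_abs (adj B)) (2 * (1 - t)))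
                * norm (op_powr (op_abs B) (2 * t) + op_powr (op_abs (adj A)) (2 * (1 - t))))
       \<and> numerical_radius (A o\<^sub>L B) \<le>
            1/4 * norm (op_abs A + op_abs (adj B)) * norm (op_abs B + op_abs (adj A))"
proof (intro conjI ballI)
  show "numerical_radius (A o\<^sub>L B) \<le>
      1/4 * norm (op_abs A + op_abs (adj B)) * norm (op_abs B + op_abs (adj A))"
    \<comment> \<open>At t = 1/2 both exponents equal 1, and the first power of a positive operator
      is the operator itself.\<close>
    using numerical_radius_compose_le[OF assms, of "1/2"]
    by (simp add: op_powr_one positive_op_abs clinear_op_adj assms)
qed (rule numerical_radius_compose_le; use assms in simp)

end
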